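(* Let $E$ be a holomorphic vector bundle over a domain $D\subset\mathbb{C}^n$, and let $h$ be a singular Finsler metric on $E$ such that $|s|_{h^*}$ is upper semi-continuous for any local holomorphic section $s$ of $E^*$. If $(E,h)$ satisfies the optimal $L^p$-extension condition for some $p>0$, then $(E,h)$ is Griffiths semi-positive.
   Context: A (singular) Finsler metric $h$ on a holomorphic vector bundle $E$ is a function $h:E\to[0,+\infty]$ such that, writing $|v|_h^2:=h(v)$, one has $|cv|^2_h=|c|^2|v|_h^2$ for all $v\in E$, $c\in\mathbb C$. The dual Finsler metric $h^*$ on $E^*$ is defined as follows: for $\xi\in E^*_x$, $|\xi|_{h^*}:=0$ if $|v|_h=+\infty$ for all nonzero $v\in E_x$; otherwise $|\xi|_{h^*}:=\sup\{|\xi(v)|: v\in E_x,\ |v|_h\leq1\}\le+\infty$. $(E,h)$ is Griffiths semi-positive (positively curved in the sense of Griffiths) if for any local holomorphic section $s$ of $E^*$, the function $\log|s|^2_{h^*}$ is plurisubharmonic. A holomorphic cylinder is a domain of the form $A(P_{r,s})$ for some $A\in U(n)$ and $r,s>0$, where $P_{r,s}=\{(z_1,\dots,z_n):|z_1|^2<r^2,\ |z_2|^2+\cdots+|z_n|^2<s^2\}$. Optimal $L^p$-extension condition: for any $z\in D$, any $a\in E_z$ with $|a|_h=1$, and any holomorphic cylinder $P$ with $z+P\subset D$, there is $f\in H^0(z+P,E)$ such that $f(z)=a$ and $$\frac1{\mu(P)}\int_{z+P}|f|_h^p\leq1,$$ where the integral is with respect to Lebesgue measure and $\mu(P)$ is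 the Lebesgue volume of $P$. The rank of $E$ may be finite or infinite (in the infinite rank case the fibers are modeled on a separable complex Hilbert space).
   Formalization: Upper semi-continuity of |s|_{h*} is taken to include that it is finite everywhere; if the value +∞ is allowed the claim fails, e.g. on the disc with h(z,v)=|v|² for z≠0 and h(0,v)=0, where log|1|²_{h*} is +∞ at 0. *)

theory Defs
  imports "HOL-Analysis.Analysis"
begin

section \<open>Complex normed and Hilbert spaces\<close>

class complex_vector = real_vector +
  fixes scaleC :: "complex \<Rightarrow> 'a \<Rightarrow> 'a" (infixr "*\<^sub>C" 75)
  assumes scaleC_add_right: "c *\<^sub>C (x + y) = c *\<^sub>C x + c *\<^sub>C y"
    and scaleC_add_left: "(c + d) *\<^sub>C x = c *\<^sub>C x + d *\<^sub>C x"
    and scaleC_scaleC: "c *\<^sub>C (d *\<^sub>C x) = (c * d) *\<^sub>C x"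
    and scaleC_one: "1 *\<^sub>C x = x"
    and scaleR_scaleC: "r *\<^sub>R x = complex_of_real r *\<^sub>C x"

class complex_normed_vector = complex_vector + real_normed_vector +
  assumes norm_scaleC: "norm (c *\<^sub>C x) = cmod c * norm x"

text \<open>The last axiom makes \<open>cinner\<close> positive definite and says that it induces the norm.
  Separable Hilbert spaces are those that are also of class \<open>second_countable_topology\<close>.\<close>

class complex_hilbert = complex_normed_vector + banach +
  fixes cinner :: "'a \<Rightarrow> 'a \<Rightarrow> complex"
  assumes cinner_commute: "cinner x y = cnj (cinner y x)"
    and cinner_add_left: "cinner (x + y) z = cinner x z + cinner y z"
    and cinner_scaleC_left: "cinner (c *\<^sub>C x) y = c * cinner x y"
    and cinner_self: "cinner x x = complex_of_real ((norm x)\<^sup>2)"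

instantiation complex :: complex_hilbert
begin

definition "c *\<^sub>C x = c * x" for c x :: complex
definition "cinner x y = x * cnj y" for x y :: complex

instance
  by standard
    (simp_all add: scaleC_complex_def cinner_complex_def algebra_simps norm_mult scaleR_conv_of_real
      complex_norm_square del: of_real_power)

end

text \<open>This covers the base space \<open>complex ^ 'n\<close> and, as model fibres, all finite ranks.\<close>

instantiation vec :: (complex_vector, finite) complex_vector
begin

definition "c *\<^sub>C x = (\<chi> i. c *\<^sub>C (x $ i))" for x :: "('a, 'b) vec"

instance
  by standard
    (simp_all add: scaleC_vec_def vec_eq_iff scaleC_add_right scaleC_add_left scaleC_scaleC
      scaleC_one scaleR_scaleC)

end

instance vec :: (complex_normed_vector, finite) complex_normed_vector
  by standard (simp add: norm_vec_def scaleC_vec_def norm_scaleC L2_set_right_distrib)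

instantiation vec :: (complex_hilbert, finite) complex_hilbert
begin

definition "cinner x y = (\<Sum>i\<in>UNIV. cinner (x $ i) (y $ i))" for x y :: "('a, 'b) vec"

instance
proof
  fix x y z :: "('a, 'b) vec" and c :: complex
  have "(\<Sum>i\<in>UNIV. cinner (x $ i) (y $ i)) = (\<Sum>i\<in>UNIV. cnj (cinner (y $ i) (x $ i)))"
    by (intro sum.cong refl cinner_commute)
  then show "cinner x y = cnj (cinner y x)"
    by (simp add: cinner_vec_def)
  show "cinner (x + y) z = cinner x z + cinner y z"
    by (simp add: cinner_vec_def cinner_add_left sum.distrib)
  show "cinner (c *\<^sub>C x) y = c * cinner x y"
    by (simp add: cinner_vec_def scaleC_vec_def cinner_scaleC_left sum_distrib_left)
  show "cinner x x = complex_of_real ((norm x)\<^sup>2)"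
    by (simp add: cinner_vec_def cinner_self norm_vec_def L2_set_def sum_nonneg del: of_real_power)
qed

end

text \<open>
  \<open>'a \<Rightarrow>\<^sub>L 'b\<close> consists of the bounded \<^emph>\<open>real\<close>-linear maps; the complex-linear ones are
  a closed complex subspace with the same operator norm.
\<close>

instantiation blinfun :: (real_normed_vector, complex_normed_vector) complex_normed_vector
begin

definition "c *\<^sub>C A = Blinfun (\<lambda>x. c *\<^sub>C blinfun_apply A x)" for A :: "'a \<Rightarrow>\<^sub>L 'b"

lemma blinfun_apply_scaleC: "blinfun_apply (c *\<^sub>C A) x = c *\<^sub>C blinfun_apply A x"
  for A :: "'a \<Rightarrow>\<^sub>L 'b"
proof -
  have "bounded_linear (\<lambda>x. c *\<^sub>C blinfun_apply A x)"
  proof (rule bounded_linear_intro[where K = "cmod c * norm A"])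
    fix x y :: 'a and r :: real
    show "c *\<^sub>C A (x + y) = c *\<^sub>C A x + c *\<^sub>C A y"
      by (simp add: blinfun.add_right scaleC_add_right)
    show "c *\<^sub>C A (r *\<^sub>R x) = r *\<^sub>R c *\<^sub>C A x"
      by (simp add: blinfun.scaleR_right scaleR_scaleC scaleC_scaleC mult.commute)
    show "norm (c *\<^sub>C A x) \<le> norm x * (cmod c * norm A)"
      using mult_left_mono[OF norm_blinfun[of A x] norm_ge_zero[of c]]
      by (simp add: norm_scaleC mult_ac)
  qed
  then show ?thesis
    unfolding scaleC_blinfun_def by (simp add: bounded_linear_Blinfun_apply)
qed

instance
proof
  fix c d :: complex and r :: real and A B :: "'a \<Rightarrow>\<^sub>L 'b"
  show "c *\<^sub>C (A + B) = c *\<^sub>C A + c *\<^sub>C B" "(c + d) *\<^sub>C A = c *\<^sub>C A + d *\<^sub>C A"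
    "c *\<^sub>C d *\<^sub>C A = (c * d) *\<^sub>C A" "1 *\<^sub>C A = A" "r *\<^sub>R A = complex_of_real r *\<^sub>C A"
    by (auto intro!: blinfun_eqI simp: blinfun_apply_scaleC blinfun.add_left blinfun.scaleR_left
        scaleC_add_right scaleC_add_left scaleC_scaleC scaleC_one scaleR_scaleC)
  have le: "norm (c *\<^sub>C A) \<le> cmod c * norm A" for c and A :: "'a \<Rightarrow>\<^sub>L 'b"
  proof (rule norm_blinfun_bound)
    show "norm ((c *\<^sub>C A) x) \<le> cmod c * norm A * norm x" for x
      using mult_left_mono[OF norm_blinfun[of A x] norm_ge_zero[of c]]
      by (simp add: blinfun_apply_scaleC norm_scaleC mult_ac)
  qed simp
  show "norm (c *\<^sub>C A) = cmod c * norm A"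
  proof (cases "c = 0")
    case True
    then show ?thesis using le[of 0 A] by simp
  next
    case False
    have "A = inverse c *\<^sub>C c *\<^sub>C A"
      using False by (auto intro!: blinfun_eqI simp: blinfun_apply_scaleC scaleC_scaleC scaleC_one)
    then have "norm A \<le> cmod (inverse c) * norm (c *\<^sub>C A)"
      using le[of "inverse c" "c *\<^sub>C A"] by simp
    then have "norm A \<le> norm (c *\<^sub>C A) / cmod c"
      by (simp add: norm_inverse divide_inverse mult.commute)
    then have "cmod c * norm A \<le> norm (c *\<^sub>C A)"
      using False by (simp add: pos_le_divide_eq mult.commute)
    with le[of c A] show ?thesis by simp
  qed
qed

end

text \<open>Only used for open \<open>U\<close>: Frechet differentiable with complex-linear derivative.\<close>

definition holomorphic_map_on ::
  "('a::complex_normed_vector \<Rightarrow> 'b::complex_normed_vector) \<Rightarrow> 'a set \<Rightarrow> bool" where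
  "holomorphic_map_on f U \<longleftrightarrow>
    (\<forall>x\<in>U. \<exists>f'. (f has_derivative f') (at x) \<and> (\<forall>c v. f' (c *\<^sub>C v) = c *\<^sub>C f' v))"


section \<open>Plurisubharmonic functions\<close>

text \<open>
  As usual in potential theory, upper semicontinuous functions do not take the value \<open>\<infinity>\<close>;
  they may take the value \<open>-\<infinity>\<close>.  Likewise the constant \<open>-\<infinity>\<close> counts as (pluri)subharmonic.
\<close>

definition usc_on :: "'a::topological_space set \<Rightarrow> ('a \<Rightarrow> 'b::{linorder,order_top}) \<Rightarrow> bool" where
  "usc_on U f \<longleftrightarrow>
    (\<forall>x\<in>U. f x < top) \<and> (\<forall>c. openin (top_of_set U) {x\<in>U. f x < c})"

text \<open>Integral of the positive part minus that of the negative part; meaningful as soon as one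
  of the two is finite, as for functions bounded above on a space of finite measure.\<close>

definition ereal_integral :: "'a measure \<Rightarrow> ('a \<Rightarrow> ereal) \<Rightarrow> ereal" where
  "ereal_integral M f =
    enn2ereal (\<integral>\<^sup>+x. e2ennreal (f x) \<partial>M) - enn2ereal (\<integral>\<^sup>+x. e2ennreal (- f x) \<partial>M)"

definition circle_mean :: "(complex \<Rightarrow> ereal) \<Rightarrow> complex \<Rightarrow> real \<Rightarrow> ereal" where
  "circle_mean u a r =
    ereal_integral (restrict_space lborel {0..2 * pi}) (\<lambda>t. u (a + of_real r * cis t))
      / ereal (2 * pi)"

definition subharmonic_on :: "complex set \<Rightarrow> (complex \<Rightarrow> ereal) \<Rightarrow> bool" where
  "subharmonic_on U u \<longleftrightarrow> open U \<and> usc_on U u \<and>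
    (\<forall>a r. 0 < r \<and> cball a r \<subseteq> U \<longrightarrow> u a \<le> circle_mean u a r)"

definition plurisubharmonic_on :: "(complex ^ 'n) set \<Rightarrow> (complex ^ 'n \<Rightarrow> ereal) \<Rightarrow> bool" where
  "plurisubharmonic_on U u \<longleftrightarrow> open U \<and> usc_on U u \<and>
    (\<forall>a w. subharmonic_on {t. a + t *\<^sub>C w \<in> U} (\<lambda>t. u (a + t *\<^sub>C w)))"


section \<open>Holomorphic vector bundles\<close>

text \<open>
  A bundle over a subset of \<open>complex ^ 'n\<close> with model fibre \<open>'f\<close>: total space, projection, fibrewise
  zero, addition and scalar multiplication, and an atlas of local trivializations.  A pair
  \<open>(U, \<phi>)\<close> in \<open>trivs\<close> stands for the trivialization \<open>v \<mapsto> (proj v, \<phi> v)\<close> of the part of the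
  total space over \<open>U\<close> onto \<open>U \<times> 'f\<close>.
\<close>

record ('e, 'n::finite, 'f) vbundle =
  total :: "'e set"
  proj :: "'e \<Rightarrow> complex ^ 'n"
  fzero :: "complex ^ 'n \<Rightarrow> 'e"
  fadd :: "'e \<Rightarrow> 'e \<Rightarrow> 'e"
  fscale :: "complex \<Rightarrow> 'e \<Rightarrow> 'e"
  trivs :: "((complex ^ 'n) set \<times> ('e \<Rightarrow> 'f)) set"

definition fibre :: "('e, 'n::finite, 'f) vbundle \<Rightarrow> complex ^ 'n \<Rightarrow> 'e set" where
  "fibre E x = {v \<in> total E. proj E v = x}"

text \<open>
  The vector space axioms for the fibres are inherited from \<open>'f\<close> through the linear bijections.
  The complex structure (and topology) on the total space is the one given by the atlas.
  Transition functions are holomorphic for the operator norm.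
\<close>

definition holomorphic_vector_bundle ::
  "(complex ^ 'n) set \<Rightarrow> ('e, 'n::finite, 'f::complex_hilbert) vbundle \<Rightarrow> bool" where
  "holomorphic_vector_bundle D E \<longleftrightarrow>
    proj E ` total E \<subseteq> D \<and>
    (\<Union>(U, \<phi>)\<in>trivs E. U) = D \<and>
    (\<forall>(U, \<phi>)\<in>trivs E. open U \<and>
      (\<forall>x\<in>U. bij_betw \<phi> (fibre E x) UNIV \<and>
        fzero E x \<in> fibre E x \<and> \<phi> (fzero E x) = 0 \<and>
        (\<forall>v\<in>fibre E x. \<forall>w\<in>fibre E x.
          fadd E v w \<in> fibre E x \<and> \<phi> (fadd E v w) = \<phi> v + \<phi> w) \<and>
        (\<forall>c. \<forall>v\<in>fibre E x. fscale E c v \<in> fibre E x \<and> \<phi> (fscale E c v) = c *\<^sub>C \<phi> v))) \<and>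
    (\<forall>(U, \<phi>)\<in>trivs E. \<forall>(V, \<psi>)\<in>trivs E.
      \<exists>g :: complex ^ 'n \<Rightarrow> ('f \<Rightarrow>\<^sub>L 'f). holomorphic_map_on g (U \<inter> V) \<and>
        (\<forall>x\<in>U \<inter> V. \<forall>v\<in>fibre E x. \<psi> v = blinfun_apply (g x) (\<phi> v)))"

definition holomorphic_section ::
  "('e, 'n::finite, 'f::complex_hilbert) vbundle \<Rightarrow> (complex ^ 'n) set \<Rightarrow>
    (complex ^ 'n \<Rightarrow> 'e) \<Rightarrow> bool" where
  "holomorphic_section E U f \<longleftrightarrow>
    (\<forall>x\<in>U. f x \<in> fibre E x) \<and>
    (\<forall>(V, \<phi>)\<in>trivs E. holomorphic_map_on (\<lambda>x. \<phi> (f x)) (U \<inter> V))"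

text \<open>The fibre of \<open>E\<^sup>*\<close> at \<open>x\<close>: continuous linear functionals on the fibre of \<open>E\<close> at \<open>x\<close>.\<close>

definition dual_fibre ::
  "('e, 'n::finite, 'f::complex_hilbert) vbundle \<Rightarrow> complex ^ 'n \<Rightarrow> ('e \<Rightarrow> complex) set" where
  "dual_fibre E x = {\<xi>.
    (\<forall>v\<in>fibre E x. \<forall>w\<in>fibre E x. \<xi> (fadd E v w) = \<xi> v + \<xi> w) \<and>
    (\<forall>c. \<forall>v\<in>fibre E x. \<xi> (fscale E c v) = c * \<xi> v) \<and>
    (\<forall>(V, \<phi>)\<in>trivs E. x \<in> V \<longrightarrow> (\<exists>C. \<forall>v\<in>fibre E x. cmod (\<xi> v) \<le> C * norm (\<phi> v)))}"

text \<open>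
  Sections of \<open>E\<^sup>*\<close>.  The trivialization \<open>(V, \<phi>)\<close> of \<open>E\<close> induces one of \<open>E\<^sup>*\<close>, in which the section
  becomes a map \<open>L\<close> to the Banach dual of \<open>'f\<close>.
\<close>

definition holomorphic_dual_section ::
  "('e, 'n::finite, 'f::complex_hilbert) vbundle \<Rightarrow> (complex ^ 'n) set \<Rightarrow>
    (complex ^ 'n \<Rightarrow> 'e \<Rightarrow> complex) \<Rightarrow> bool" where
  "holomorphic_dual_section E U s \<longleftrightarrow>
    (\<forall>x\<in>U. s x \<in> dual_fibre E x) \<and>
    (\<forall>(V, \<phi>)\<in>trivs E. \<exists>L :: complex ^ 'n \<Rightarrow> ('f \<Rightarrow>\<^sub>L complex).
      holomorphic_map_on L (U \<inter> V) \<and>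
      (\<forall>x\<in>U \<inter> V. \<forall>v\<in>fibre E x. s x v = blinfun_apply (L x) (\<phi> v)))"


section \<open>Singular Finsler metrics\<close>

text \<open>Intended for \<open>a > 0\<close>.\<close>

definition ennreal_powr :: "ennreal \<Rightarrow> real \<Rightarrow> ennreal" where
  "ennreal_powr x a = (if x = \<infinity> then \<infinity> else ennreal (enn2real x powr a))"

definition ennreal_log :: "ennreal \<Rightarrow> ereal" where
  "ennreal_log x =
    (if x = 0 then -\<infinity> else if x = \<infinity> then \<infinity> else ereal (ln (enn2real x)))"

text \<open>Here \<open>0 * \<infinity> = 0\<close>, so a metric vanishes on the zero section.\<close>

definition singular_finsler_metric ::
  "('e, 'n::finite, 'f) vbundle \<Rightarrow> ('e \<Rightarrow> ennreal) \<Rightarrow> bool" where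
  "singular_finsler_metric E h \<longleftrightarrow>
    (\<forall>v\<in>total E. \<forall>c. h (fscale E c v) = ennreal ((cmod c)\<^sup>2) * h v)"

text \<open>A metric \<open>h\<close> gives the \<^emph>\<open>squared\<close> length.\<close>

definition finsler_norm :: "('e \<Rightarrow> ennreal) \<Rightarrow> 'e \<Rightarrow> ennreal" where
  "finsler_norm h v = ennreal_powr (h v) (1 / 2)"

definition dual_norm ::
  "('e, 'n::finite, 'f) vbundle \<Rightarrow> ('e \<Rightarrow> ennreal) \<Rightarrow> complex ^ 'n \<Rightarrow> ('e \<Rightarrow> complex) \<Rightarrow> ennreal"
  where
  "dual_norm E h x \<xi> =
    (if \<forall>v\<in>fibre E x. v \<noteq> fzero E x \<longrightarrow> finsler_norm h v = \<infinity> then 0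
     else SUP v\<in>{v \<in> fibre E x. finsler_norm h v \<le> 1}. ennreal (cmod (\<xi> v)))"

definition griffiths_semipositive ::
  "(complex ^ 'n) set \<Rightarrow> ('e, 'n::finite, 'f::complex_hilbert) vbundle \<Rightarrow> ('e \<Rightarrow> ennreal) \<Rightarrow> bool"
  where
  "griffiths_semipositive D E h \<longleftrightarrow>
    (\<forall>U s. open U \<and> U \<subseteq> D \<and> holomorphic_dual_section E U s \<longrightarrow>
      plurisubharmonic_on U (\<lambda>x. ennreal_log ((dual_norm E h x (s x))\<^sup>2)))"

definition unitary_matrix :: "complex ^ 'n ^ 'n \<Rightarrow> bool" where
  "unitary_matrix A \<longleftrightarrow>
    A ** (\<chi> i j. cnj (A $ j $ i)) = mat 1 \<and> (\<chi> i j. cnj (A $ j $ i)) ** A = mat 1"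

text \<open>
  The index type has no distinguished first element, hence the quantification over \<open>k\<close>.  It adds
  no cylinders: permutation matrices are unitary.
\<close>

definition holomorphic_cylinder :: "(complex ^ 'n) set \<Rightarrow> bool" where
  "holomorphic_cylinder P \<longleftrightarrow>
    (\<exists>A k r s. unitary_matrix A \<and> 0 < r \<and> 0 < s \<and>
      P = (\<lambda>z. A *v z) `
        {z. (cmod (z $ k))\<^sup>2 < r\<^sup>2 \<and> (\<Sum>j\<in>UNIV - {k}. (cmod (z $ j))\<^sup>2) < s\<^sup>2})"

definition optimal_Lp_extension ::
  "(complex ^ 'n) set \<Rightarrow> ('e, 'n::finite, 'f::complex_hilbert) vbundle \<Rightarrow> ('e \<Rightarrow> ennreal) \<Rightarrow>
    real \<Rightarrow> bool" where
  "optimal_Lp_extension D E h p \<longleftrightarrow>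
    (\<forall>z\<in>D. \<forall>a\<in>fibre E z. \<forall>P.
      finsler_norm h a = 1 \<and> holomorphic_cylinder P \<and> (+) z ` P \<subseteq> D \<longrightarrow>
      (\<exists>f. holomorphic_section E ((+) z ` P) f \<and> f z = a \<and>
        (\<integral>\<^sup>+x\<in>(+) z ` P. ennreal_powr (finsler_norm h (f x)) p \<partial>lebesgue)
          / emeasure lebesgue P \<le> 1))"

end

(*
  Let N be the dual norm of a local section s of the dual bundle.  On a thin cylinder z + P around a
  point z, pick a unit vector a almost realizing N(z) and extend it to f with L^p-mean at most 1.
  Then |s(f)| <= N |f|, and the submean inequality for |s(f)|^(p/2), the circular symmetry of P and
  the Cauchy-Schwarz inequality give N(z)^p <= mean of N^p over z + P; the same holds for s
  multiplied by a holomorphic function k, hence for |k| N.  Letting the cylinder shrink to a disc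
  in a complex line, these inequalities force a maximum principle for N exp(- Re q) on the line,
  for every entire q.  As the functions Re q are dense in the continuous functions on a circle,
  the maximum principle turns into the submean inequality for log N over circles.
*)

theory Submission
  imports Defs "HOL-Complex_Analysis.Conformal_Mappings" "HOL-Computational_Algebra.Polynomial"
begin

section \<open>Circle means\<close>

text \<open>Halving the exponent makes every \<open>p > 0\<close> work: the modulus of a holomorphic
  function has the submean property for each positive power, and the squares produced by
  Cauchy-Schwarz turn \<open>p / 2\<close> back into \<open>p\<close>, so that the factor coming
  from the extension is its p-th power mean. That this mean is at most 1, and not merely bounded,
  leaves a mean value inequality without a constant, which is what a maximum principle needs. The
  inequality for N alone would speak about the p-th power of N, which is weaker than a statement
  about log N. The freedom to multiply by exp(-q) closes this gap: a bound log N <= Re q on a circle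
  passes to the centre, where Re q equals its own mean. The passage from cylinders to lines is
  delicate because a line is a null set and N is only upper semicontinuous. No limit of integrals is
  taken. Strict upper bounds on compact pieces of the line persist on thin tubes, and the share of
  volume on which the integrand is strictly smaller is bounded below independently of the
  thickness.\<close>

lemma Re_mult_Re_on_unit_circle:
  assumes "cmod z = 1"
  shows "Re (c * z ^ i) * Re (d * z ^ j) =
    Re (c * d * z ^ (i + j)) / 2 +
    Re (if j \<le> i then c * cnj d * z ^ (i - j) else cnj c * d * z ^ (j - i)) / 2"
proof -
  have zz: "z * cnj z = 1"
    using assms by (simp add: complex_norm_square[symmetric])
  \<comment> \<open>On the unit circle \<open>cnj z\<close> is the inverse of \<open>z\<close>, so
    the term with \<open>cnj b\<close> lowers the exponent. If the difference of the exponents would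
    be negative, the conjugate product has the same real part and a nonnegative exponent.\<close>
  have prod: "Re a * Re b = Re (a * b) / 2 + Re (a * cnj b) / 2" for a b :: complex
    by (simp add: field_simps)
  have pw: "z ^ m * cnj (z ^ k) = z ^ (m - k)" if "k \<le> m" for m k
  proof -
    have "z ^ m = z ^ (m - k) * z ^ k"
      using that by (simp flip: power_add)
    then have "z ^ m * cnj (z ^ k) = z ^ (m - k) * (z * cnj z) ^ k"
      by (simp add: power_mult_distrib mult.assoc)
    with zz show ?thesis by simp
  qed
  have lead: "c * z ^ i * (d * z ^ j) = c * d * z ^ (i + j)"
    by (simp add: power_add)
  have le: "x * z ^ m * cnj (y * z ^ k) = x * cnj y * z ^ (m - k)" if "k \<le> m" for x y m k
    by (simp flip: pw[OF that])
  show ?thesis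
  proof (cases "j \<le> i")
    case True
    then show ?thesis
      unfolding prod[of "c * z ^ i"] lead le[OF True] by (simp only: if_True)
  next
    case False
    then have "d * z ^ j * cnj (c * z ^ i) = cnj c * d * z ^ (j - i)"
      by (subst le) simp_all
    with False show ?thesis
      unfolding mult.commute[of "Re (c * z ^ i)"] prod[of "d * z ^ j"] lead[symmetric]
      by (simp only: if_False mult.commute[of "d * z ^ j" "c * z ^ i"])
  qed
qed

text \<open>Real parts of polynomials restricted to the unit circle are the real trigonometric
  polynomials. Closure under products is the one property required by the Stone-Weierstrass theorem
  that is not immediate in this representation.\<close>

lemma Re_poly_mult_Re_poly_on_unit_circle:
  fixes p q :: "complex poly"
  shows "\<exists>s. \<forall>z. cmod z = 1 \<longrightarrow> Re (poly p z) * Re (poly q z) = Re (poly s z)"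
proof -
  define t where "t i j = smult (1 / 2) (monom (coeff p i * coeff q j) (i + j) +
    (if j \<le> i then monom (coeff p i * cnj (coeff q j)) (i - j)
     else monom (cnj (coeff p i) * coeff q j) (j - i)))" for i j
  define s where "s = (\<Sum>i\<le>degree p. \<Sum>j\<le>degree q. t i j)"
  have half: "Re ((1 / 2) * w) = Re w / 2" for w :: complex
    by simp
  have "Re (poly p z) * Re (poly q z) = Re (poly s z)" if "cmod z = 1" for z
  proof -
    have "Re (poly p z) * Re (poly q z) =
        (\<Sum>i\<le>degree p. \<Sum>j\<le>degree q. Re (coeff p i * z ^ i) * Re (coeff q j * z ^ j))"
      by (simp only: poly_altdef Re_sum sum_product)
    also have "\<dots> = (\<Sum>i\<le>degree p. \<Sum>j\<le>degree q. Re (poly (t i j) z))"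
    proof (intro sum.cong refl)
      fix i j
      show "Re (coeff p i * z ^ i) * Re (coeff q j * z ^ j) = Re (poly (t i j) z)"
        unfolding Re_mult_Re_on_unit_circle[OF that]
        by (simp add: t_def poly_monom half add_divide_distrib del: times_complex.simps)
    qed
    also have "\<dots> = Re (poly s z)"
      by (simp add: s_def poly_sum)
    finally show ?thesis .
  qed
  then show ?thesis by blast
qed

lemma Stone_Weierstrass_Re_poly_unit_circle:
  fixes \<psi> :: "complex \<Rightarrow> real"
  assumes "continuous_on (sphere 0 1) \<psi>" and "0 < e"
  shows "\<exists>p :: complex poly. \<forall>z\<in>sphere 0 1. \<bar>\<psi> z - Re (poly p z)\<bar> < e"
proof -
  define R :: "(complex \<Rightarrow> real) set"
    where "R = {f. \<exists>p. \<forall>z\<in>sphere 0 1. f z = Re (poly p z)}"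
  interpret function_ring_on R "sphere 0 1"
  proof
    show "compact (sphere 0 1 :: complex set)" by simp
  next
    fix f assume "f \<in> R"
    then obtain p where p: "\<forall>z\<in>sphere 0 1. f z = Re (poly p z)"
      by (auto simp: R_def)
    have "continuous_on (sphere 0 1) (\<lambda>z. Re (poly p z))"
      by (intro continuous_intros)
    with p show "continuous_on (sphere 0 1) f"
      by (metis (no_types, lifting) continuous_on_cong)
  next
    fix f g assume "f \<in> R" "g \<in> R"
    then obtain p q where pq: "\<forall>z\<in>sphere 0 1. f z = Re (poly p z)"
        "\<forall>z\<in>sphere 0 1. g z = Re (poly q z)"
      by (auto simp: R_def)
    have "\<forall>z\<in>sphere 0 1. f z + g z = Re (poly (p + q) z)"
      using pq by simp
    then show "(\<lambda>z. f z + g z) \<in> R"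
      unfolding R_def by blast
    obtain s where "\<forall>z. cmod z = 1 \<longrightarrow> Re (poly p z) * Re (poly q z) = Re (poly s z)"
      using Re_poly_mult_Re_poly_on_unit_circle by blast
    then have "\<forall>z\<in>sphere 0 1. f z * g z = Re (poly s z)"
      using pq by simp
    then show "(\<lambda>z. f z * g z) \<in> R"
      unfolding R_def by blast
  next
    fix c
    have "\<forall>z\<in>sphere 0 1. c = Re (poly [:complex_of_real c:] z)" by simp
    then show "(\<lambda>_. c) \<in> R" unfolding R_def by blast
  next
    fix x y :: complex assume "x \<noteq> y"
    have "Re \<in> R" unfolding R_def by (intro CollectI exI[of _ "[:0, 1:]"]) simp
    moreover have "Im \<in> R" unfolding R_def by (intro CollectI exI[of _ "[:0, - \<i>:]"]) simp
    ultimately show "\<exists>f\<in>R. f x \<noteq> f y"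
      using \<open>x \<noteq> y\<close> complex_eqI by blast
  qed
  obtain g where "g \<in> R" "\<forall>z\<in>sphere 0 1. \<bar>\<psi> z - g z\<bar> < e"
    using Stone_Weierstrass_basic[OF assms] by blast
  then show ?thesis
    unfolding R_def by fastforce
qed

lemma Re_entire_dense_on_sphere:
  fixes \<psi> :: "complex \<Rightarrow> real"
  assumes "continuous_on (sphere a r) \<psi>" and "0 < r" and "0 < e"
  obtains q where "q holomorphic_on UNIV" "\<And>t. t \<in> sphere a r \<Longrightarrow> \<bar>\<psi> t - Re (q t)\<bar> < e"
proof -
  have "continuous_on (sphere 0 1) (\<lambda>z. \<psi> (a + of_real r * z))"
    using assms(2) by (intro continuous_on_compose2[OF assms(1)] continuous_intros)
      (auto simp: dist_norm norm_mult)
  then obtain p :: "complex poly"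
    where p: "\<forall>z\<in>sphere 0 1. \<bar>\<psi> (a + of_real r * z) - Re (poly p z)\<bar> < e"
    using Stone_Weierstrass_Re_poly_unit_circle \<open>0 < e\<close> by blast
  show thesis
  proof
    show "(\<lambda>t. poly p ((t - a) / of_real r)) holomorphic_on UNIV"
      using assms(2) by (intro holomorphic_intros) auto
    show "\<bar>\<psi> t - Re (poly p ((t - a) / of_real r))\<bar> < e" if "t \<in> sphere a r" for t
    proof -
      have "(t - a) / of_real r \<in> sphere 0 1"
        using that assms(2) by (simp add: norm_divide dist_norm norm_minus_commute)
      with p[rule_format, OF this] show ?thesis
        using assms(2) by simp
    qed
  qed
qed

lemma entire_circle_mean:
  assumes "q holomorphic_on UNIV" and "0 < r"
  shows "((\<lambda>t. Re (q (a + of_real r * cis t))) has_integral 2 * pi * Re (q a)) {0..2 * pi}"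
proof -
  have "((\<lambda>u. q u / (u - a)) has_contour_integral 2 * of_real pi * \<i> * q a) (circlepath a r)"
    using assms by (intro Cauchy_integral_circlepath_simple) (auto intro: holomorphic_on_subset)
  then have "((\<lambda>t. q (a + of_real r * cis t) / (of_real r * cis t) * of_real r * \<i> * cis t)
      has_integral 2 * of_real pi * \<i> * q a) {0..2 * pi}"
    unfolding circlepath_def by (simp add: has_contour_integral_part_circlepath_iff)
  \<comment> \<open>Along the circle dz / (z - a) equals \<open>\<i>\<close> dt, which cancels the
    radius. The imaginary part of \<open>\<i> * w\<close> is the real part of
    \<open>w\<close>.\<close>
  then have "((\<lambda>t. \<i> * q (a + of_real r * cis t)) has_integral \<i> * (2 * of_real pi * q a)) {0..2 * pi}"
    using assms(2) by (simp add: mult_ac)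
  then have "((\<lambda>t. Im (\<i> * q (a + of_real r * cis t))) has_integral Im (\<i> * (2 * of_real pi * q a)))
      {0..2 * pi}"
    by (rule has_integral_linear[OF _ bounded_linear_Im, unfolded o_def])
  then show ?thesis by simp
qed

text \<open>Density yields entire \<open>q\<close> with real part just above \<psi> on the circle,
  and \<open>Re (q a)\<close> is the circle mean of \<open>Re q\<close>. The assumption
  \<open>le\<close> is the form in which a maximum principle delivers its information: only through
  majorants that are real parts of entire functions.\<close>

lemma le_circle_mean_continuous:
  fixes \<psi> :: "complex \<Rightarrow> real"
  assumes "continuous_on (sphere a r) \<psi>" and "0 < r"
    and le: "\<And>q. q holomorphic_on UNIV \<Longrightarrow> (\<And>t. t \<in> sphere a r \<Longrightarrow> \<psi> t \<le> Re (q t)) \<Longrightarrow> c \<le> Re (q a)"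
  shows "2 * pi * c \<le> integral {0..2 * pi} (\<lambda>t. \<psi> (a + of_real r * cis t))"
proof (rule field_le_epsilon)
  fix e :: real assume "0 < e"
  \<comment> \<open>The error is paid twice, each time as \<open>2 * pi * d = e / 2\<close>: once
    for lifting \<open>q\<close> above \<psi>, once for comparing the integrals of
    \<open>Re q\<close> and \<psi>.\<close>
  define d where "d = e / (4 * pi)"
  have "0 < d" using \<open>0 < e\<close> by (simp add: d_def)
  obtain q where q: "q holomorphic_on UNIV" "\<And>t. t \<in> sphere a r \<Longrightarrow> \<bar>\<psi> t - Re (q t)\<bar> < d"
    using Re_entire_dense_on_sphere[OF assms(1,2) \<open>0 < d\<close>] by blast
  have "c \<le> Re (q a + of_real d)"
  proof (rule le)
    show "(\<lambda>t. q t + of_real d) holomorphic_on UNIV"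
      by (intro holomorphic_intros q)
    show "\<psi> t \<le> Re (q t + of_real d)" if "t \<in> sphere a r" for t
      using q(2)[OF that] by simp
  qed
  then have c: "2 * pi * c \<le> 2 * pi * Re (q a) + e / 2"
    using mult_left_mono[of c "Re (q a) + d" "2 * pi"] by (simp add: d_def distrib_left)
  have on: "a + of_real r * cis t \<in> sphere a r" for t
    using assms(2) by (simp add: dist_norm norm_mult)
  have cont: "continuous_on {0..2 * pi} (\<lambda>t. \<psi> (a + of_real r * cis t))"
    using on by (intro continuous_on_compose2[OF assms(1)] continuous_intros) auto
  have "2 * pi * Re (q a) = integral {0..2 * pi} (\<lambda>t. Re (q (a + of_real r * cis t)))"
    using entire_circle_mean[OF q(1) assms(2), of a] by (simp add: integral_unique)
  also have "\<dots> \<le> integral {0..2 * pi} (\<lambda>t. \<psi> (a + of_real r * cis t) + d)"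
  proof (rule integral_le)
    show "Re (q (a + of_real r * cis t)) \<le> \<psi> (a + of_real r * cis t) + d" for t
      using q(2)[OF on, of t] by simp
  qed (use has_integral_integrable[OF entire_circle_mean[OF q(1) assms(2)]] in
      \<open>auto intro!: integrable_continuous_real[OF continuous_on_add] cont\<close>)
  also have "\<dots> = integral {0..2 * pi} (\<lambda>t. \<psi> (a + of_real r * cis t)) + e / 2"
    by (subst Henstock_Kurzweil_Integration.integral_add)
      (auto intro!: integrable_continuous_real cont simp: d_def)
  finally show "2 * pi * c \<le> integral {0..2 * pi} (\<lambda>t. \<psi> (a + of_real r * cis t)) + e"
    using c by simp
qed

section \<open>Upper semicontinuous functions on compact sets and their circle means\<close>

lemma usc_on_compact_bounded_above:
  fixes u :: "'a::topological_space \<Rightarrow> ereal"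
  assumes "usc_on S u" "compact S"
  obtains C :: real where "0 \<le> C" "\<And>x. x \<in> S \<Longrightarrow> u x \<le> ereal C"
proof -
  have bd: "\<exists>n::nat. u x < ereal n" if "x \<in> S" for x
  proof -
    have "u x < \<infinity>" using assms(1) that by (auto simp: usc_on_def top_ereal_def)
    then show ?thesis
      by (cases "u x") (auto simp: reals_Archimedean2)
  qed
  have "\<forall>n::nat. \<exists>T. open T \<and> {x \<in> S. u x < ereal n} = S \<inter> T"
    using assms(1) by (auto simp: usc_on_def openin_open)
  then obtain T where T: "\<And>n::nat. open (T n)" "\<And>n. {x \<in> S. u x < ereal (real n)} = S \<inter> T n"
    by metis
  have "S \<subseteq> (\<Union>n. T n)"
  proof
    fix x assume "x \<in> S"
    then obtain n :: nat where "x \<in> {x \<in> S. u x < ereal n}" using bd by blast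
    then show "x \<in> (\<Union>n. T n)" unfolding T(2) by blast
  qed
  then obtain F where F: "finite F" "S \<subseteq> (\<Union>n\<in>F. T n)"
    using compactE_image[OF assms(2), of UNIV T] T(1) by metis
  show thesis
  proof
    \<comment> \<open>The sum dominates each index in \<open>F\<close> and, unlike a maximum, makes
      sense for empty \<open>F\<close>.\<close>
    show "u x \<le> ereal (\<Sum>n\<in>F. real n)" if x: "x \<in> S" for x
    proof -
      obtain n where n: "n \<in> F" "x \<in> T n" using F(2) x by blast
      then have "u x < ereal (real n)" using T(2)[of n] x by blast
      also have "real n \<le> (\<Sum>n\<in>F. real n)"
        using n F(1) by (intro member_le_sum) auto
      finally show ?thesis by (simp add: less_imp_le)
    qed
  qed (simp add: sum_nonneg)
qed

text \<open>An upper semicontinuous function on a compact set is the pointwise limit of the Lipschitz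
  functions obtained by sup-convolution with \<open>k * dist\<close>, after truncation from below at \<open>- k\<close>.\<close>

lemma usc_on_compact_continuous_approx:
  fixes u :: "'a::metric_space \<Rightarrow> ereal"
  assumes "usc_on S u" "compact S"
  obtains C and \<psi> :: "nat \<Rightarrow> 'a \<Rightarrow> real" where "0 \<le> C" "\<And>x. x \<in> S \<Longrightarrow> u x \<le> ereal C"
    "\<And>k. continuous_on S (\<psi> k)" "\<And>k x. x \<in> S \<Longrightarrow> u x \<le> \<psi> k x" "\<And>k x. x \<in> S \<Longrightarrow> \<psi> k x \<le> C"
    "\<And>x c. x \<in> S \<Longrightarrow> u x < ereal c \<Longrightarrow> eventually (\<lambda>k. \<psi> k x \<le> c) sequentially"
proof -
  obtain C :: real where C: "0 \<le> C" "\<And>x. x \<in> S \<Longrightarrow> u x \<le> ereal C"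
    using usc_on_compact_bounded_above[OF assms] by blast
  define v where "v k x = real_of_ereal (max (u x) (ereal (- real k)))" for k x
  have v: "ereal (v k x) = max (u x) (ereal (- real k))" if "x \<in> S" for k x
  proof -
    have "max (u x) (ereal (- real k)) \<noteq> \<infinity>" using C(2)[OF that] by (auto simp: max_def)
    moreover have "max (u x) (ereal (- real k)) \<noteq> - \<infinity>"
      by (metis MInfty_neq_ereal(1) ereal_infty_less_eq(2) max.cobounded2)
    ultimately show ?thesis by (cases "max (u x) (ereal (- real k))") (simp_all add: v_def)
  qed
  have vC: "v k x \<le> C" if "x \<in> S" for k x
  proof -
    have "max (u x) (ereal (- real k)) \<le> ereal C"
      using C(1) C(2)[OF that] by simp
    then show ?thesis
      by (simp flip: v[OF that, of k])
  qed
  define \<psi> where "\<psi> k x = (SUP y\<in>S. v k y - real k * dist x y)" for k x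
  have bdd: "bdd_above ((\<lambda>y. v k y - real k * dist x y) ` S)" for k x
  proof (rule bdd_aboveI2)
    show "v k y - real k * dist x y \<le> C" if "y \<in> S" for y
      using vC[OF that, of k] by (smt (verit) mult_nonneg_nonneg of_nat_0_le_iff zero_le_dist)
  qed
  have lip: "\<psi> k x \<le> \<psi> k x' + real k * dist x x'" if "S \<noteq> {}" for k x x'
    unfolding \<psi>_def
  proof (rule cSUP_least[OF that])
    fix y assume y: "y \<in> S"
    have "real k * dist x' y \<le> real k * dist x x' + real k * dist x y"
      by (metis dist_commute dist_triangle distrib_left mult_left_mono of_nat_0_le_iff)
    moreover have "v k y - real k * dist x' y \<le> (SUP y\<in>S. v k y - real k * dist x' y)"
      by (rule cSUP_upper[OF y bdd])
    ultimately show "v k y - real k * dist x y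
        \<le> (SUP y\<in>S. v k y - real k * dist x' y) + real k * dist x x'"
      by linarith
  qed
  show thesis
  proof (rule that[of C \<psi>])
    show "continuous_on S (\<psi> k)" for k
    proof (cases "S = {}")
      case False
      have "dist (\<psi> k x) (\<psi> k x') \<le> real k * dist x x'" for x x'
        using lip[OF False, of k x x'] lip[OF False, of k x' x]
        by (simp add: dist_real_def dist_commute abs_le_iff)
      then have "(real k)-lipschitz_on S (\<psi> k)" by (intro lipschitz_onI) auto
      then show ?thesis by (rule lipschitz_on_continuous_on)
    qed simp
    show "u x \<le> \<psi> k x" if "x \<in> S" for k x
    proof -
      have "v k x - real k * dist x x \<le> \<psi> k x"
        unfolding \<psi>_def by (rule cSUP_upper[OF that bdd])
      then have "ereal (v k x) \<le> ereal (\<psi> k x)" by simp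
      then show ?thesis using v[OF that, of k] by simp
    qed
    show "\<psi> k x \<le> C" if "x \<in> S" for k x
      unfolding \<psi>_def
    proof (rule cSUP_least)
      show "v k y - real k * dist x y \<le> C" if "y \<in> S" for y
        using vC[OF that, of k] by (smt (verit) mult_nonneg_nonneg of_nat_0_le_iff zero_le_dist)
    qed (use that in auto)
    show "eventually (\<lambda>k. \<psi> k x \<le> c) sequentially" if x: "x \<in> S" and c: "u x < ereal c" for x c
    proof -
      obtain T where T: "open T" "{y \<in> S. u y < ereal c} = S \<inter> T"
        using assms(1) unfolding usc_on_def openin_open by blast
      then have "x \<in> T" using x c by blast
      then obtain d where d: "0 < d" "ball x d \<subseteq> T" using T(1) open_contains_ball by blast
      \<comment> \<open>The first bound puts the truncation level \<open>- k\<close> below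
        \<open>c\<close>, which settles the points near \<open>x\<close>. The second makes the
        penalty \<open>k * dist\<close> at least \<open>C - c\<close> outside the ball, where only
        the global bound \<open>C\<close> is available.\<close>
      have "eventually (\<lambda>k. - c \<le> real k) sequentially" "eventually (\<lambda>k. (C - c) / d \<le> real k) sequentially"
        using filterlim_real_sequentially filterlim_at_top by blast+
      then show ?thesis
      proof eventually_elim
        case (elim k)
        show "\<psi> k x \<le> c"
          unfolding \<psi>_def
        proof (rule cSUP_least)
          fix y assume y: "y \<in> S"
          show "v k y - real k * dist x y \<le> c"
          proof (cases "dist x y < d")
            case True
            then have "u y < ereal c" using d(2) T(2) y by (auto simp: ball_def)
            then have "ereal (v k y) \<le> ereal c"
              using v[OF y, of k] elim(1) by simp
            then show ?thesis
              by (smt (verit) ereal_less_eq(3) mult_nonneg_nonneg of_nat_0_le_iff zero_le_dist)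
          next
            case False
            have "C - c \<le> real k * d"
              using elim(2) d(1) by (simp add: pos_divide_le_eq)
            also have "\<dots> \<le> real k * dist x y"
              using False by (intro mult_left_mono) auto
            finally show ?thesis using vC[OF y, of k] by linarith
          qed
        qed (use x in auto)
      qed
    qed
  qed (use C in auto)
qed

text \<open>A majorant of an approximant \<open>\<psi> k\<close> is a majorant of \<open>u\<close>,
  so the continuous case applies to each \<open>\<psi> k\<close>. Fatou's lemma for the nonnegative
  functions \<open>C - \<psi> k\<close> then passes to \<open>u\<close>, including the points where
  \<open>u\<close> is -\<infinity>.\<close>

lemma le_circle_mean_usc:
  assumes usc: "usc_on (sphere a r) u" and r: "0 < r"
    and le: "\<And>q. q holomorphic_on UNIV \<Longrightarrow> (\<And>t. t \<in> sphere a r \<Longrightarrow> u t \<le> ereal (Re (q t))) \<Longrightarrow>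
      c \<le> ereal (Re (q a))"
  shows "c \<le> circle_mean u a r"
proof -
  obtain C and \<psi> :: "nat \<Rightarrow> complex \<Rightarrow> real" where C: "0 \<le> C" "\<And>x. x \<in> sphere a r \<Longrightarrow> u x \<le> ereal C"
    and cont: "\<And>k. continuous_on (sphere a r) (\<psi> k)"
    and \<psi>: "\<And>k x. x \<in> sphere a r \<Longrightarrow> u x \<le> \<psi> k x" "\<And>k x. x \<in> sphere a r \<Longrightarrow> \<psi> k x \<le> C"
    "\<And>x c. x \<in> sphere a r \<Longrightarrow> u x < ereal c \<Longrightarrow> eventually (\<lambda>k. \<psi> k x \<le> c) sequentially"
    by (rule usc_on_compact_continuous_approx[OF usc compact_sphere]) blast
  define z where "z t = a + of_real r * cis t" for t
  have z: "z t \<in> sphere a r" for t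
    using r by (simp add: z_def dist_norm norm_mult)
  have contz: "continuous_on UNIV z"
    unfolding z_def by (intro continuous_intros)
  \<comment> \<open>The constant \<open>C\<close> is itself an admissible majorant. This excludes
    \<open>c = \<infinity>\<close> and later makes \<open>C - c'\<close> nonnegative, so that
    \<open>ennreal\<close> does not truncate it.\<close>
  have cC: "c \<le> ereal C"
    using le[of "\<lambda>_. of_real C"] C by simp
  show ?thesis
  proof (cases c)
    case PInf
    with cC show ?thesis by simp
  next
    case MInf
    then show ?thesis by simp
  next
    case (real c')
    define M where "M = restrict_space lborel {0..2 * pi :: real}"
    have [measurable]: "(\<lambda>t. u (z t)) \<in> borel_measurable borel"
    proof (rule borel_measurableI_less)
      fix y
      obtain T where T: "open T" "{x \<in> sphere a r. u x < y} = sphere a r \<inter> T"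
        using usc unfolding usc_on_def openin_open by blast
      have "{t \<in> space borel. u (z t) < y} = z -` T"
      proof (intro set_eqI)
        fix t
        have "z t \<in> {x \<in> sphere a r. u x < y} \<longleftrightarrow> z t \<in> sphere a r \<inter> T"
          by (simp only: T(2))
        then show "t \<in> {t \<in> space borel. u (z t) < y} \<longleftrightarrow> t \<in> z -` T"
          using z[of t] by simp
      qed
      moreover have "open (z -` T)"
        using contz T(1) by (simp add: open_vimage)
      ultimately show "{t \<in> space borel. u (z t) < y} \<in> sets borel" by simp
    qed
    have M: "emeasure M (space M) = ennreal (2 * pi)"
      by (simp add: M_def emeasure_restrict_space space_restrict_space)
    have [measurable]: "(\<lambda>t. u (z t)) \<in> borel_measurable M"
      unfolding M_def by (rule measurable_restrict_space1) simp
    have cont\<psi>: "continuous_on {0..2 * pi} (\<lambda>t. C - \<psi> k (z t))" for k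
      using z by (intro continuous_intros continuous_on_compose2[OF cont] continuous_on_subset[OF contz]) auto
    \<comment> \<open>Fatou's lemma bounds \<open>X\<close>, whereas \<open>circle_mean\<close> is
      built from the positive part \<open>U\<close> and the negative part \<open>V\<close>. The
      pointwise identity behind \<open>X + U = 2 * pi * C + V\<close> contains no difference of
      infinities, so it holds for infinite \<open>u\<close> as well and shows that \<open>V\<close>
      is finite.\<close>
    define X where "X = (\<integral>\<^sup>+t. e2ennreal (ereal C - u (z t)) \<partial>M)"
    define U where "U = (\<integral>\<^sup>+t. e2ennreal (u (z t)) \<partial>M)"
    define V where "V = (\<integral>\<^sup>+t. e2ennreal (- u (z t)) \<partial>M)"
    have meas: "(\<lambda>t. ennreal (C - \<psi> k (z t))) \<in> borel_measurable M" for k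
    proof -
      have "(\<lambda>t. C - \<psi> k (z t)) \<in> borel_measurable (restrict_space borel {0..2 * pi})"
        using cont\<psi> by (intro borel_measurable_continuous_on_restrict)
      moreover have "sets M = sets (restrict_space borel {0..2 * pi})"
        by (simp add: M_def sets_restrict_space)
      ultimately have "(\<lambda>t. C - \<psi> k (z t)) \<in> borel_measurable M"
        using measurable_cong_sets by blast
      then show ?thesis by simp
    qed
    have int_le: "(\<integral>\<^sup>+t. ennreal (C - \<psi> k (z t)) \<partial>M) \<le> ennreal (2 * pi * (C - c'))" for k
    proof -
      have "2 * pi * c' \<le> integral {0..2 * pi} (\<lambda>t. \<psi> k (a + of_real r * cis t))"
      proof (rule le_circle_mean_continuous[OF cont r])
        show "c' \<le> Re (q a)" if "q holomorphic_on UNIV" "\<And>t. t \<in> sphere a r \<Longrightarrow> \<psi> k t \<le> Re (q t)" for q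
          using le[OF that(1)] that(2) \<psi>(1)[of _ k] real
          by (metis ereal_less_eq(3) order_trans)
      qed
      then have "integral {0..2 * pi} (\<lambda>t. C - \<psi> k (z t)) \<le> 2 * pi * (C - c')"
        using z by (subst Henstock_Kurzweil_Integration.integral_diff)
          (auto simp: z_def[symmetric] right_diff_distrib intro!: integrable_continuous_real 
            continuous_on_compose2[OF cont] continuous_on_subset[OF contz])
      moreover have "(\<integral>\<^sup>+t. ennreal (C - \<psi> k (z t)) \<partial>M) = ennreal (integral {0..2 * pi} (\<lambda>t. C - \<psi> k (z t)))"
      proof -
        have "(\<integral>\<^sup>+t. ennreal (indicator {0..2 * pi} t * (C - \<psi> k (z t))) \<partial>lborel)
            = ennreal (integral {0..2 * pi} (\<lambda>t. C - \<psi> k (z t)))"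
        proof (rule nn_integral_has_integral_lborel)
          have "(\<lambda>t. indicator {0..2 * pi} t *\<^sub>R (C - \<psi> k (z t))) \<in> borel_measurable borel"
            using cont\<psi> by (intro borel_measurable_continuous_on_indicator) auto
          then show "(\<lambda>t. indicator {0..2 * pi} t * (C - \<psi> k (z t))) \<in> borel_measurable borel"
            by simp
          have "((\<lambda>t. if t \<in> {0..2 * pi} then C - \<psi> k (z t) else 0) has_integral
              integral {0..2 * pi} (\<lambda>t. C - \<psi> k (z t))) UNIV"
            unfolding has_integral_restrict_UNIV
            by (intro integrable_integral integrable_continuous_real cont\<psi>)
          then show "((\<lambda>t. indicator {0..2 * pi} t * (C - \<psi> k (z t))) has_integral
              integral {0..2 * pi} (\<lambda>t. C - \<psi> k (z t))) UNIV"
            by (rule back_subst[of "\<lambda>f. (f has_integral _) _"]) (auto simp: fun_eq_iff)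
          show "0 \<le> indicator {0..2 * pi} t * (C - \<psi> k (z t))" for t
            using \<psi>(2)[OF z] by (simp add: indicator_def)
        qed
        moreover have "ennreal (indicator {0..2 * pi} t * (C - \<psi> k (z t))) =
            ennreal (C - \<psi> k (z t)) * indicator {0..2 * pi} t" for t
          by (simp add: indicator_def)
        ultimately show ?thesis
          by (simp add: M_def nn_integral_restrict_space)
      qed
      ultimately show ?thesis by (simp add: ennreal_leI)
    qed
    have "e2ennreal (ereal C - u (z t)) \<le> liminf (\<lambda>k. ennreal (C - \<psi> k (z t)))" for t
      unfolding le_Liminf_iff
    proof (intro allI impI)
      fix y :: ennreal assume y: "y < e2ennreal (ereal C - u (z t))"
      then obtain y' where y': "y = ennreal y'" "0 \<le> y'"
        by (cases y) auto
      have "\<not> ereal C - u (z t) \<le> ereal y'"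
        using e2ennreal_mono[of "ereal C - u (z t)" "ereal y'"] y y' by auto
      then have "u (z t) < ereal (C - y')"
        by (cases "u (z t)") auto
      then obtain w where "u (z t) < w" "w < ereal (C - y')"
        using dense by blast
      then obtain w' where w': "u (z t) < ereal w'" "w' < C - y'"
        by (cases w) auto
      from \<psi>(3)[OF z w'(1)] show "eventually (\<lambda>k. y < ennreal (C - \<psi> k (z t))) sequentially"
        by eventually_elim (use w'(2) y' in \<open>simp add: ennreal_lessI\<close>)
    qed
    then have "X \<le> (\<integral>\<^sup>+t. liminf (\<lambda>k. ennreal (C - \<psi> k (z t))) \<partial>M)"
      unfolding X_def by (intro nn_integral_mono)
    also have "\<dots> \<le> liminf (\<lambda>k. \<integral>\<^sup>+t. ennreal (C - \<psi> k (z t)) \<partial>M)"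
      by (rule nn_integral_liminf[OF meas])
    also have "\<dots> \<le> ennreal (2 * pi * (C - c'))"
      by (intro Liminf_le always_eventually allI int_le) simp
    finally have X: "X \<le> ennreal (2 * pi * (C - c'))" .
    have "X + U = (\<integral>\<^sup>+t. e2ennreal (ereal C - u (z t)) + e2ennreal (u (z t)) \<partial>M)"
      unfolding X_def U_def by (rule nn_integral_add[symmetric]) measurable
    also have "\<dots> = (\<integral>\<^sup>+t. ennreal C + e2ennreal (- u (z t)) \<partial>M)"
    proof (rule nn_integral_cong)
      show "e2ennreal (ereal C - u (z t)) + e2ennreal (u (z t)) = ennreal C + e2ennreal (- u (z t))" for t
      proof (cases "u (z t)")
        case (real x)
        then have "x \<le> C" using C(2)[OF z, of t] by simp
        then show ?thesis
          using real C(1) by (cases "0 \<le> x") (auto simp: ennreal_neg simp flip: ennreal_plus)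
      qed (use C(2)[OF z, of t] in \<open>auto simp: e2ennreal_neg\<close>)
    qed
    also have "\<dots> = ennreal (2 * pi * C) + V"
      unfolding V_def using C(1) by (subst nn_integral_add) (auto simp: M ennreal_mult mult_ac)
    finally have eq: "X + U = ennreal (2 * pi * C) + V" .
    have "U \<le> (\<integral>\<^sup>+t. ennreal C \<partial>M)"
      unfolding U_def using e2ennreal_mono[OF C(2)[OF z]] by (intro nn_integral_mono) simp
    then have U: "U \<le> ennreal (2 * pi * C)"
      using C(1) by (simp add: M ennreal_mult mult_ac)
    obtain x where x: "X = ennreal x" "0 \<le> x"
      using X by (cases X) (auto simp: top_unique)
    obtain y where y: "U = ennreal y" "0 \<le> y"
      using U by (cases U) (auto simp: top_unique)
    obtain v where v: "V = ennreal v" "0 \<le> v"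
      using eq x y by (cases V) auto
    have c'C: "c' \<le> C" using cC real by simp
    have "x \<le> 2 * pi * (C - c')"
      using X x c'C by simp
    moreover have "x + y = 2 * pi * C + v"
      using eq x y v C(1) by (simp flip: ennreal_plus)
    ultimately have "2 * pi * c' \<le> y - v"
      by (simp add: algebra_simps)
    then have "c' \<le> (y - v) / (2 * pi)"
      by (simp add: pos_le_divide_eq mult.commute)
    moreover have "circle_mean u a r = ereal ((y - v) / (2 * pi))"
      using y v by (simp add: circle_mean_def ereal_integral_def z_def[symmetric] M_def[symmetric]
          U_def[symmetric] V_def[symmetric])
    ultimately show ?thesis using real by simp
  qed
qed

text \<open>Jensen's inequality for exp, applied to the logarithm of the modulus. The logarithm is
  cut off from below so that it stays continuous at zeros of \<open>F\<close>; its submean property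
  follows from the maximum modulus principle for \<open>F z * exp (- q z)\<close>.\<close>

lemma circle_mean_cmod_powr:
  assumes "F holomorphic_on S" "open S" "cball 0 1 \<subseteq> S" and "0 < \<alpha>"
  shows "ennreal (2 * pi * cmod (F 0) powr \<alpha>)
    \<le> (\<integral>\<^sup>+t. indicator {0..2 * pi} t * ennreal (cmod (F (cis t)) powr \<alpha>) \<partial>lborel)"
proof (cases "F 0 = 0")
  case True
  then show ?thesis by simp
next
  case False
  have contF: "continuous_on (sphere 0 1) F"
    using assms by (auto intro!: continuous_on_subset[OF holomorphic_on_imp_continuous_on])
  have contFc: "continuous_on {0..2 * pi} (\<lambda>t. F (cis t))"
    by (intro continuous_on_compose2[OF contF] continuous_intros) auto
  have cont\<alpha>: "continuous_on {0..2 * pi} (\<lambda>t. cmod (F (cis t)) powr \<alpha>)"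
    using assms(4) by (intro continuous_on_powr' continuous_intros contFc) auto
  define I where "I = integral {0..2 * pi} (\<lambda>t. cmod (F (cis t)) powr \<alpha>)"
  have "2 * pi * cmod (F 0) powr \<alpha> \<le> I"
  proof (rule field_le_epsilon)
    fix d :: real assume "0 < d"
    \<comment> \<open>With this cutoff the error \<open>e powr \<alpha>\<close> is
      \<open>d / (2 * pi)\<close> at each point, hence \<open>d\<close> after integration over the
      circle.\<close>
    define e where "e = (d / (2 * pi)) powr (1 / \<alpha>)"
    have e: "0 < e" "e powr \<alpha> = d / (2 * pi)"
      using \<open>0 < d\<close> assms(4) by (auto simp: e_def powr_powr)
    define \<psi> where "\<psi> z = ln (max (cmod (F z)) e)" for z
    define c where "c = ln (cmod (F 0))"
    have cont\<psi>: "continuous_on (sphere 0 1) \<psi>"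
      unfolding \<psi>_def using e by (intro continuous_intros contF) auto
    have cont\<psi>c: "continuous_on {0..2 * pi} (\<lambda>t. \<psi> (cis t))"
      by (intro continuous_on_compose2[OF cont\<psi>] continuous_intros) auto
    have "2 * pi * c \<le> integral {0..2 * pi} (\<lambda>t. \<psi> (0 + of_real 1 * cis t))"
    proof (rule le_circle_mean_continuous[OF cont\<psi>])
      fix q assume q: "q holomorphic_on UNIV" "\<And>t. t \<in> sphere 0 1 \<Longrightarrow> \<psi> t \<le> Re (q t)"
      have "cmod (F 0 * exp (- q 0)) \<le> 1"
      proof (rule maximum_modulus_frontier[of "\<lambda>z. F z * exp (- q z)" "cball 0 1" 1 0])
        show "(\<lambda>z. F z * exp (- q z)) holomorphic_on interior (cball 0 1)"
          using assms(3) by (intro holomorphic_intros holomorphic_on_subset[OF assms(1)]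
              holomorphic_on_subset[OF q(1)]) auto
        show "continuous_on (closure (cball 0 1)) (\<lambda>z. F z * exp (- q z))"
          using assms(3) by (intro holomorphic_on_imp_continuous_on holomorphic_intros
              holomorphic_on_subset[OF assms(1)] holomorphic_on_subset[OF q(1)]) auto
        show "cmod (F z * exp (- q z)) \<le> 1" if "z \<in> frontier (cball 0 1)" for z
        proof -
          have "\<psi> z \<le> Re (q z)" using that q(2) by simp
          moreover have "cmod (F z) \<le> exp (\<psi> z)"
            using e by (simp add: \<psi>_def)
          ultimately have "cmod (F z) \<le> exp (Re (q z))"
            by (meson exp_le_cancel_iff order_trans)
          then show ?thesis
            by (simp add: norm_mult norm_exp_eq_Re exp_minus[of "Re _"] pos_divide_le_eq flip: divide_inverse)
        qed
      qed auto
      then have "cmod (F 0) \<le> exp (Re (q 0))"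
        by (simp add: norm_mult norm_exp_eq_Re exp_minus[of "Re _"] pos_divide_le_eq flip: divide_inverse)
      then show "c \<le> Re (q 0)"
        using False unfolding c_def by (metis exp_ln_iff ln_exp ln_le_cancel_iff exp_gt_zero zero_less_norm_iff)
    qed simp
    then have mean: "2 * pi * c \<le> integral {0..2 * pi} (\<lambda>t. \<psi> (cis t))" by simp
    have pw: "max (cmod (F z)) e powr \<alpha> = exp (\<alpha> * \<psi> z)" for z
      using e by (auto simp: \<psi>_def powr_def)
    have F0: "cmod (F 0) powr \<alpha> = exp (\<alpha> * c)"
      using False by (simp add: c_def powr_def)
    \<comment> \<open>Jensen by way of the tangent of exp at \<open>\<alpha> * c\<close>. The mean
      of \<psi> is at least \<open>c\<close>, so the linear term contributes a nonnegative amount;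
      the tangent is then compared with exp under the integral.\<close>
    have "2 * pi * cmod (F 0) powr \<alpha>
        \<le> exp (\<alpha> * c) * (2 * pi + \<alpha> * (integral {0..2 * pi} (\<lambda>t. \<psi> (cis t)) - 2 * pi * c))"
      using mean assms(4) by (simp add: F0)
    also have "\<dots> = integral {0..2 * pi} (\<lambda>t. exp (\<alpha> * c) * (1 + \<alpha> * (\<psi> (cis t) - c)))"
    proof -
      have "((\<lambda>t. exp (\<alpha> * c) * (1 + \<alpha> * (\<psi> (cis t) - c))) has_integral
          exp (\<alpha> * c) * (2 * pi + \<alpha> * (integral {0..2 * pi} (\<lambda>t. \<psi> (cis t)) - 2 * pi * c))) {0..2 * pi}"
        using has_integral_const_real[of "1::real" 0 "2 * pi"] has_integral_const_real[of c 0 "2 * pi"]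
        by (intro has_integral_mult_right has_integral_add has_integral_diff
            integrable_integral integrable_continuous_real cont\<psi>c) auto
      then show ?thesis by (rule integral_unique[symmetric])
    qed
    also have "\<dots> \<le> integral {0..2 * pi} (\<lambda>t. cmod (F (cis t)) powr \<alpha> + d / (2 * pi))"
    proof (rule integral_le)
      fix t
      have "exp (\<alpha> * c) * (1 + \<alpha> * (\<psi> (cis t) - c)) \<le> exp (\<alpha> * c) * exp (\<alpha> * (\<psi> (cis t) - c))"
        by (intro mult_left_mono exp_ge_add_one_self) auto
      also have "\<dots> = max (cmod (F (cis t))) e powr \<alpha>"
        by (simp add: pw algebra_simps flip: exp_add)
      also have "\<dots> \<le> cmod (F (cis t)) powr \<alpha> + e powr \<alpha>"
        by (simp add: max_def)
      finally show "exp (\<alpha> * c) * (1 + \<alpha> * (\<psi> (cis t) - c)) \<le> cmod (F (cis t)) powr \<alpha> + d / (2 * pi)"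
        using e by simp
    qed (auto intro!: integrable_continuous_real continuous_intros cont\<psi>c cont\<alpha>)
    also have "\<dots> = I + d"
      by (subst Henstock_Kurzweil_Integration.integral_add)
        (auto simp: I_def intro!: integrable_continuous_real cont\<alpha>)
    finally show "2 * pi * cmod (F 0) powr \<alpha> \<le> I + d" .
  qed
  moreover have "(\<integral>\<^sup>+t. ennreal (indicator {0..2 * pi} t * (cmod (F (cis t)) powr \<alpha>)) \<partial>lborel) = ennreal I"
  proof -
    have "set_borel_measurable borel {0..2 * pi} (\<lambda>t. cmod (F (cis t)) powr \<alpha>)"
      unfolding set_borel_measurable_def
      by (intro borel_measurable_continuous_on_indicator cont\<alpha>) auto
    then have "(\<lambda>t. indicator {0..2 * pi} t * (cmod (F (cis t)) powr \<alpha>)) \<in> borel_measurable borel"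
      by (simp add: set_borel_measurable_def)
    moreover have "((\<lambda>t. indicator {0..2 * pi} t * (cmod (F (cis t)) powr \<alpha>)) has_integral I) UNIV"
    proof -
      have "((\<lambda>t. cmod (F (cis t)) powr \<alpha>) has_integral I) {0..2 * pi}"
        unfolding I_def by (intro integrable_integral integrable_continuous_real cont\<alpha>)
      then have "((\<lambda>t. if t \<in> {0..2 * pi} then cmod (F (cis t)) powr \<alpha> else 0) has_integral I) UNIV"
        by (simp only: has_integral_restrict_UNIV)
      moreover have "(\<lambda>t. if t \<in> {0..2 * pi} then cmod (F (cis t)) powr \<alpha> else 0) =
          (\<lambda>t. indicator {0..2 * pi} t * (cmod (F (cis t)) powr \<alpha>))"
        by (auto simp: fun_eq_iff)
      ultimately show ?thesis by (simp only:)
    qed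
    ultimately show ?thesis
      by (intro nn_integral_has_integral_lborel) auto
  qed
  moreover have "indicator A t * ennreal x = ennreal (indicator A t * x)" for A :: "real set" and t x
    by (simp add: indicator_def)
  ultimately show ?thesis
    by (metis (no_types, lifting) ennreal_leI nn_integral_cong)
qed

section \<open>Translations and isometries of Lebesgue measure\<close>

lemma nn_integral_lborel_translate:
  fixes g :: "'a::euclidean_space \<Rightarrow> ennreal"
  assumes [measurable]: "g \<in> borel_measurable borel"
  shows "(\<integral>\<^sup>+x. g (c + x) \<partial>lborel) = (\<integral>\<^sup>+x. g x \<partial>lborel)"
proof -
  have "(\<integral>\<^sup>+x. g x \<partial>lborel) = (\<integral>\<^sup>+x. g x \<partial>distr lborel borel ((+) c))"
    by (simp add: lborel_distr_plus)
  then show ?thesis by (simp add: nn_integral_distr)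
qed

lemma emeasure_lborel_open_nonzero:
  assumes "open S" "S \<noteq> {}"
  shows "emeasure lborel S \<noteq> 0"
proof -
  have "\<not> negligible S"
    using assms by (rule open_not_negligible)
  then have "S \<notin> null_sets lborel"
    using null_sets_completionI by (auto simp: negligible_iff_null_sets)
  then show ?thesis using assms by (simp add: null_sets_def)
qed

lemma emeasure_lborel_translate:
  fixes P :: "'a::euclidean_space set"
  assumes [measurable]: "P \<in> sets borel"
  shows "(+) z ` P \<in> sets borel" and "emeasure lborel ((+) z ` P) = emeasure lborel P"
proof -
  have "(+) z ` P = (\<lambda>x. x - z) -` P \<inter> space borel"
  proof (intro set_eqI iffI)
    fix x assume "x \<in> (\<lambda>x. x - z) -` P \<inter> space borel"
    then show "x \<in> (+) z ` P" by (intro image_eqI[of _ _ "x - z"]) auto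
  qed auto
  also have "\<dots> \<in> sets borel" by measurable
  finally show [measurable]: "(+) z ` P \<in> sets borel" .
  have "(\<integral>\<^sup>+x. indicator ((+) z ` P) (z + x) \<partial>lborel) = (\<integral>\<^sup>+x. indicator ((+) z ` P) x \<partial>lborel)"
    by (rule nn_integral_lborel_translate) measurable
  moreover have "indicator ((+) z ` P) (z + x) = (indicator P x :: ennreal)" for x
    by (auto simp: indicator_def)
  ultimately show "emeasure lborel ((+) z ` P) = emeasure lborel P" by simp
qed

text \<open>The uniqueness argument for Haar measure: both sides, multiplied by the volume of the unit
  ball, equal the integral of \<open>g x\<close> over the pairs \<open>(x, y)\<close> with \<open>norm (x - T y) < 1\<close>.\<close>

lemma nn_integral_lborel_orthogonal_transformation:
  fixes T :: "'a::euclidean_space \<Rightarrow> 'a"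
  assumes T: "orthogonal_transformation T" and [measurable]: "g \<in> borel_measurable borel"
  shows "(\<integral>\<^sup>+x. g (T x) \<partial>lborel) = (\<integral>\<^sup>+x. g x \<partial>lborel)"
proof -
  define S where "S = inv T"
  have S: "T (S x) = x" for x
    using T orthogonal_transformation_surj S_def surj_f_inv_f by metis
  have [measurable]: "T \<in> borel_measurable borel"
    using T by (intro borel_measurable_continuous_onI linear_continuous_on
        orthogonal_transformation_linear linear_conv_bounded_linear[THEN iffD1])
  have Tadd: "T (x + y) = T x + T y" and Tdiff: "T (x - y) = T x - T y" and Tn: "norm (T x) = norm x"
    for x y
    using T by (simp_all add: orthogonal_transformation linear_add linear_diff)
  have dist: "norm (x - T y) = dist (S x) y" for x y
    by (metis S Tdiff Tn dist_norm)
  define V where "V = emeasure lborel (ball (0::'a) 1)"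
  have V: "V \<noteq> 0" "V \<noteq> \<infinity>" and Vc: "emeasure lborel (ball c 1) = V" for c :: 'a
    using less_imp_neq[OF unit_ball_vol_pos[of "real DIM('a)"]] by (auto simp: V_def emeasure_ball)
  define b :: "'a \<Rightarrow> ennreal" where "b = indicator (ball 0 1)"
  have [measurable]: "b \<in> borel_measurable borel"
    unfolding b_def by (rule borel_measurable_indicator) simp
  have "(\<integral>\<^sup>+x. g x \<partial>lborel) * V = (\<integral>\<^sup>+x. g x * (\<integral>\<^sup>+y. b (x - T y) \<partial>lborel) \<partial>lborel)"
  proof -
    have "(\<integral>\<^sup>+y. b (x - T y) \<partial>lborel) = V" for x
    proof -
      have "b (x - T y) = indicator (ball (S x) 1) y" for y
        by (simp add: b_def indicator_def dist)
      then show ?thesis by (simp add: Vc)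
    qed
    then show ?thesis by (simp add: nn_integral_multc)
  qed
  also have "\<dots> = (\<integral>\<^sup>+x. (\<integral>\<^sup>+y. g x * b (x - T y) \<partial>lborel) \<partial>lborel)"
    by (simp add: nn_integral_cmult)
  also have "\<dots> = (\<integral>\<^sup>+y. (\<integral>\<^sup>+x. g x * b (x - T y) \<partial>lborel) \<partial>lborel)"
    by (rule lborel_pair.Fubini') measurable
  also have "\<dots> = (\<integral>\<^sup>+y. (\<integral>\<^sup>+x. g (T y + x) * b x \<partial>lborel) \<partial>lborel)"
  proof -
    have "(\<integral>\<^sup>+x. g (T y + x) * b (T y + x - T y) \<partial>lborel) = (\<integral>\<^sup>+x. g x * b (x - T y) \<partial>lborel)" for y
      by (rule nn_integral_lborel_translate) measurable
    then show ?thesis by simp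
  qed
  also have "\<dots> = (\<integral>\<^sup>+x. (\<integral>\<^sup>+y. g (T y + x) * b x \<partial>lborel) \<partial>lborel)"
    by (rule lborel_pair.Fubini') measurable
  also have "\<dots> = (\<integral>\<^sup>+x. (\<integral>\<^sup>+y. g (T y) \<partial>lborel) * b x \<partial>lborel)"
  proof -
    have "(\<integral>\<^sup>+y. g (T y + x) \<partial>lborel) = (\<integral>\<^sup>+y. g (T y) \<partial>lborel)" for x
    proof -
      have "(\<integral>\<^sup>+y. g (T (S x + y)) \<partial>lborel) = (\<integral>\<^sup>+y. g (T y) \<partial>lborel)"
        by (rule nn_integral_lborel_translate) measurable
      then show ?thesis by (simp add: Tadd S add.commute)
    qed
    then show ?thesis by (simp add: nn_integral_multc)
  qed
  also have "\<dots> = (\<integral>\<^sup>+y. g (T y) \<partial>lborel) * V"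
  proof -
    have "(\<integral>\<^sup>+x. b x \<partial>lborel) = V"
      by (simp add: b_def V_def)
    then show ?thesis by (simp add: nn_integral_cmult)
  qed
  finally show ?thesis
    using V by (simp add: mult.commute[of _ V] ennreal_mult_cancel_left)
qed

section \<open>Cylinders\<close>

text \<open>The complex Householder reflection in the hyperplane orthogonal to \<open>v\<close>. For
  \<open>v = 0\<close> the quotient is 0 and the matrix is the identity, a case that does occur when
  a vector already has the desired direction.\<close>

definition householder :: "complex ^ 'n \<Rightarrow> complex ^ 'n ^ 'n" where
  "householder v = (\<chi> i j. (if i = j then 1 else 0) - 2 / of_real ((norm v)\<^sup>2) * (v $ i * cnj (v $ j)))"

lemma norm_vec_complex_power2: "complex_of_real ((norm v)\<^sup>2) = (\<Sum>i\<in>UNIV. v $ i * cnj (v $ i))"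
  for v :: "complex ^ 'n"
  by (simp add: cinner_self[symmetric] cinner_vec_def cinner_complex_def del: of_real_power)

text \<open>Let P be the product of \<open>v\<close> with its conjugate transpose and N the squared
  norm. Then PP = NP, so the square of 1 - cP differs from 1 by (ccN - 2c)P, which vanishes for c =
  2/N; if N = 0, division by zero gives c = 0.\<close>

lemma householder_mult_self: "householder v ** householder v = mat 1"
proof -
  define N where "N = complex_of_real ((norm v)\<^sup>2)"
  define c where "c = 2 / N"
  have N: "(\<Sum>l\<in>UNIV. v $ l * cnj (v $ l)) = N"
    unfolding N_def by (rule norm_vec_complex_power2[symmetric])
  have c: "c * c * N = c + c"
    by (cases "N = 0") (simp_all add: c_def field_simps)
  have "(\<Sum>l\<in>UNIV. ((if i = l then 1 else 0) - c * (v $ i * cnj (v $ l))) *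
      ((if l = j then 1 else 0) - c * (v $ l * cnj (v $ j)))) = (if i = j then 1 else 0)" for i j
  proof -
    define m where "m = v $ i * cnj (v $ j)"
    have "(\<Sum>l\<in>UNIV. ((if i = l then 1 else 0) - c * (v $ i * cnj (v $ l))) *
        ((if l = j then 1 else 0) - c * (v $ l * cnj (v $ j)))) =
      (\<Sum>l\<in>UNIV. (if l = i then (if i = j then 1 else 0) - c * m else 0)
        - (if l = j then c * m else 0) + c * c * m * (v $ l * cnj (v $ l)))"
    proof (intro sum.cong refl)
      fix l
      show "((if i = l then 1 else 0) - c * (v $ i * cnj (v $ l))) *
          ((if l = j then 1 else 0) - c * (v $ l * cnj (v $ j))) =
        (if l = i then (if i = j then 1 else 0) - c * m else 0)
        - (if l = j then c * m else 0) + c * c * m * (v $ l * cnj (v $ l))"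
        unfolding m_def by (cases "l = i"; cases "l = j") (simp_all add: algebra_simps)
    qed
    also have "\<dots> = (if i = j then 1 else 0) - c * m - c * m + c * c * m * N"
      by (simp add: sum.distrib sum_subtractf N flip: sum_distrib_left)
    also have "\<dots> = (if i = j then 1 else 0) + (c * c * N - (c + c)) * m"
      by (simp add: algebra_simps)
    finally show ?thesis by (simp add: c)
  qed
  then show ?thesis
    by (simp add: vec_eq_iff matrix_matrix_mult_def householder_def mat_def N_def c_def)
qed

text \<open>A Householder matrix is Hermitian, so being an involution makes it unitary; the phase
  \<open>c\<close> cancels against its conjugate.\<close>

lemma unitary_matrix_unimodular_householder:
  assumes "cmod c = 1"
  shows "unitary_matrix (\<chi> i j. c * householder v $ i $ j)"
proof -
  have cc: "c * cnj c = 1"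
    using assms by (simp add: complex_norm_square[symmetric])
  have herm: "cnj (householder v $ j $ i) = householder v $ i $ j" for i j
    by (simp add: householder_def mult_ac)
  have prod: "(\<Sum>l\<in>UNIV. (a * householder v $ i $ l) * (b * householder v $ l $ j)) =
      (if i = j then 1 else 0)" if "a * b = 1" for a b i j
  proof -
    have "(\<Sum>l\<in>UNIV. (a * householder v $ i $ l) * (b * householder v $ l $ j)) =
        (a * b) * (householder v ** householder v) $ i $ j"
      by (simp add: matrix_matrix_mult_def sum_distrib_left mult_ac)
    then show ?thesis
      by (simp add: that householder_mult_self mat_def)
  qed
  then show ?thesis
    using prod[of c "cnj c"] prod[of "cnj c" c] cc
    by (simp add: unitary_matrix_def vec_eq_iff matrix_matrix_mult_def mat_def herm mult.commute[of "cnj c" c])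
qed

text \<open>The reflection in x - y exchanges two vectors x, y of equal norm provided that their
  inner product is real. The phase \<open>c\<close> arranges this for x =
  \<open>c *s axis k 1\<close> and y = \<open>u\<close>, because \<open>c * cnj (u $ k)\<close> is
  \<open>cmod (u $ k)\<close>. Multiplying the reflection by \<open>c\<close> sends the axis vector
  itself to \<open>u\<close>.\<close>

lemma exists_unitary_matrix_axis:
  fixes u :: "complex ^ 'n"
  assumes "norm u = 1"
  shows "\<exists>A. unitary_matrix A \<and> A *v axis k 1 = u"
proof -
  define c where "c = (if u $ k = 0 then 1 else u $ k / of_real (cmod (u $ k)))"
  have c: "cmod c = 1" by (simp add: c_def norm_divide)
  have cu: "c * cnj (u $ k) = of_real (cmod (u $ k))"
    by (simp add: c_def complex_norm_square[symmetric] power2_eq_square)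
  define v where "v = c *s axis k 1 - u"
  define s where "s = cmod (u $ k)"
  have vi: "v $ i = (if i = k then c else 0) - u $ i" for i
    by (simp add: v_def axis_def)
  have N: "complex_of_real ((norm v)\<^sup>2) = 2 - 2 * of_real s"
  proof -
    have "complex_of_real ((norm v)\<^sup>2) = (\<Sum>i\<in>UNIV. (if i = k then c * cnj c - c * cnj (u $ k) - cnj (c * cnj (u $ k)) else 0)
        + u $ i * cnj (u $ i))"
      unfolding norm_vec_complex_power2 by (intro sum.cong refl) (auto simp: vi algebra_simps)
    also have "\<dots> = c * cnj c - c * cnj (u $ k) - cnj (c * cnj (u $ k)) + complex_of_real ((norm u)\<^sup>2)"
      by (simp add: sum.distrib norm_vec_complex_power2 del: of_real_power)
    also have "\<dots> = 2 - 2 * of_real s"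
      unfolding cu using c assms by (simp add: s_def complex_norm_square[symmetric])
    finally show ?thesis .
  qed
  have "c * householder v $ i $ k = u $ i" for i
  proof -
    have ck: "c * cnj (v $ k) = 1 - of_real s"
      using cu c by (simp add: vi s_def right_diff_distrib complex_norm_square[symmetric])
    have "c * householder v $ i $ k = (if i = k then c else 0) -
        v $ i * (2 / of_real ((norm v)\<^sup>2) * (c * cnj (v $ k)))"
      by (simp add: householder_def algebra_simps)
    also have "\<dots> = (if i = k then c else 0) - v $ i"
    proof (cases "v = 0")
      case False
      then have "complex_of_real ((norm v)\<^sup>2) \<noteq> 0" by simp
      moreover have "2 * (1 - of_real s) = complex_of_real ((norm v)\<^sup>2)"
        unfolding N by (simp add: right_diff_distrib)
      ultimately have "2 / complex_of_real ((norm v)\<^sup>2) * (1 - of_real s) = 1"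
        by (metis divide_self times_divide_eq_left)
      then show ?thesis by (simp only: ck) simp
    qed simp
    finally show ?thesis by (simp add: vi)
  qed
  then have "(\<chi> i j. c * householder v $ i $ j) *v axis k 1 = u"
    by (simp add: vec_eq_iff matrix_vector_mult_def axis_def if_distrib cong: if_cong)
  with unitary_matrix_unimodular_householder[OF c] show ?thesis by blast
qed

lemma cinner_unitary_matrix:
  fixes A :: "complex ^ 'n ^ 'n"
  assumes "unitary_matrix A"
  shows "cinner (A *v x) (A *v y) = cinner x y"
proof -
  have eq: "(\<Sum>i\<in>UNIV. cnj (A $ i $ l) * A $ i $ j) = (if l = j then 1 else 0)" for l j
    using assms by (simp add: unitary_matrix_def vec_eq_iff matrix_matrix_mult_def mat_def)
  have "cinner (A *v x) (A *v y) =
      (\<Sum>i\<in>UNIV. \<Sum>j\<in>UNIV. \<Sum>l\<in>UNIV. (A $ i $ j * x $ j) * cnj (A $ i $ l * y $ l))"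
    by (simp add: cinner_vec_def cinner_complex_def matrix_vector_mult_def sum_product)
  also have "\<dots> = (\<Sum>j\<in>UNIV. \<Sum>i\<in>UNIV. \<Sum>l\<in>UNIV. (A $ i $ j * x $ j) * cnj (A $ i $ l * y $ l))"
    by (rule sum.swap)
  also have "\<dots> = (\<Sum>j\<in>UNIV. \<Sum>l\<in>UNIV. \<Sum>i\<in>UNIV. (A $ i $ j * x $ j) * cnj (A $ i $ l * y $ l))"
    by (intro sum.cong refl sum.swap)
  also have "\<dots> = (\<Sum>j\<in>UNIV. \<Sum>l\<in>UNIV. x $ j * cnj (y $ l) * (\<Sum>i\<in>UNIV. cnj (A $ i $ l) * A $ i $ j))"
    by (simp add: sum_distrib_left mult_ac)
  also have "\<dots> = cinner x y"
    by (simp add: eq cinner_vec_def cinner_complex_def if_distrib cong: if_cong)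
  finally show ?thesis .
qed

text \<open>The coordinate of the orthogonal projection onto the complex line through
  \<open>w\<close>, measured in multiples of \<open>w\<close> and not in length. For nonzero
  \<open>w\<close> it recovers the parameter \<open>t\<close> of the line
  \<open>a + t *\<^sub>C w\<close> after subtraction of \<open>a\<close>.\<close>

definition lcoord :: "complex ^ 'n \<Rightarrow> complex ^ 'n \<Rightarrow> complex" where
  "lcoord w x = cinner x w / of_real ((norm w)\<^sup>2)"

text \<open>A cylinder with axis \<open>w\<close> whose disc factor is centred at \<open>b\<close>.
  The radius \<rho> refers to the line parameter, the thickness \<sigma> to the norm of the
  orthogonal part. A centre other than 0 is needed for the sub-tubes on which a function is strictly
  smaller.\<close>

definition tube :: "complex ^ 'n \<Rightarrow> complex \<Rightarrow> real \<Rightarrow> real \<Rightarrow> (complex ^ 'n) set" where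
  "tube w b \<rho> \<sigma> = {x. cmod (lcoord w x - b) < \<rho> \<and> norm (x - lcoord w x *\<^sub>C w) < \<sigma>}"

lemma lcoord_add: "lcoord w (x + y) = lcoord w x + lcoord w y"
  by (simp add: lcoord_def cinner_add_left add_divide_distrib)

lemma lcoord_scaleC: "lcoord w (c *\<^sub>C x) = c * lcoord w x"
  by (simp add: lcoord_def cinner_scaleC_left)

lemma lcoord_self: "w \<noteq> 0 \<Longrightarrow> lcoord w w = 1"
  by (simp add: lcoord_def cinner_self)

lemma bounded_linear_lcoord: "bounded_linear (lcoord w)"
  by (intro linear_conv_bounded_linear[THEN iffD1] linearI)
    (simp_all add: lcoord_add lcoord_scaleC scaleR_scaleC scaleC_complex_def)

lemma bounded_linear_scaleC_left: "bounded_linear (\<lambda>c. c *\<^sub>C x)" for x :: "'a::complex_normed_vector"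
  by (rule bounded_linear_intro[where K = "norm x"])
    (simp_all add: scaleC_add_left scaleR_scaleC scaleC_scaleC scaleC_complex_def norm_scaleC)

lemma bounded_linear_scaleC_right: "bounded_linear (\<lambda>x::'a::complex_normed_vector. c *\<^sub>C x)"
  by (rule bounded_linear_intro[where K = "cmod c"])
    (simp_all add: scaleC_add_right scaleR_scaleC scaleC_scaleC mult.commute norm_scaleC)

lemmas scaleC_zero_left = linear_0[OF bounded_linear.linear[OF bounded_linear_scaleC_left]]
  and scaleC_zero_right = linear_0[OF bounded_linear.linear[OF bounded_linear_scaleC_right]]
  and scaleC_diff_right = linear_diff[OF bounded_linear.linear[OF bounded_linear_scaleC_right]]

lemma open_tube: "open (tube w b \<rho> \<sigma>)"
proof -
  have "continuous_on UNIV (lcoord w)"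
    by (rule linear_continuous_on[OF bounded_linear_lcoord])
  moreover from this have "continuous_on UNIV (\<lambda>x. lcoord w x *\<^sub>C w)"
    by (rule bounded_linear.continuous_on[OF bounded_linear_scaleC_left])
  ultimately show ?thesis
    unfolding tube_def by (intro open_Collect_conj open_Collect_less continuous_intros)
qed

lemma norm_less_of_mem_tube:
  assumes "x \<in> tube w 0 \<rho> \<sigma>"
  shows "norm x < \<rho> * norm w + \<sigma>"
proof -
  have "norm x \<le> norm (lcoord w x *\<^sub>C w) + norm (x - lcoord w x *\<^sub>C w)"
    using norm_triangle_ineq[of "lcoord w x *\<^sub>C w" "x - lcoord w x *\<^sub>C w"] by simp
  also have "norm (lcoord w x *\<^sub>C w) \<le> \<rho> * norm w"
    using assms by (simp add: tube_def norm_scaleC mult_right_mono)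
  finally show ?thesis using assms by (simp add: tube_def)
qed

lemma emeasure_tube_finite: "emeasure lborel (tube w 0 \<rho> \<sigma>) < \<infinity>"
proof -
  have "bounded (tube w 0 \<rho> \<sigma>)"
    by (rule boundedI[of _ "\<rho> * norm w + \<sigma>"]) (rule less_imp_le[OF norm_less_of_mem_tube])
  then show ?thesis by (rule emeasure_bounded_finite)
qed

lemma zero_mem_tube: "0 < \<rho> \<Longrightarrow> 0 < \<sigma> \<Longrightarrow> 0 \<in> tube w 0 \<rho> \<sigma>"
  by (simp add: tube_def linear_0[OF bounded_linear.linear[OF bounded_linear_lcoord]] scaleC_zero_left)

lemma emeasure_tube_pos:
  assumes "0 < \<rho>" "0 < \<sigma>"
  shows "emeasure lborel (tube w 0 \<rho> \<sigma>) \<noteq> 0"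
  using emeasure_lborel_open_nonzero[OF open_tube] zero_mem_tube[OF assms] by blast

lemma tube_scaleC:
  assumes "x \<in> tube w 0 \<rho> \<sigma>" "cmod c \<le> 1"
  shows "c *\<^sub>C x \<in> tube w 0 \<rho> \<sigma>"
proof -
  have "c *\<^sub>C x - lcoord w (c *\<^sub>C x) *\<^sub>C w = c *\<^sub>C (x - lcoord w x *\<^sub>C w)"
    by (simp add: lcoord_scaleC scaleC_scaleC scaleC_diff_right)
  then have "norm (c *\<^sub>C x - lcoord w (c *\<^sub>C x) *\<^sub>C w) \<le> norm (x - lcoord w x *\<^sub>C w)"
    using assms(2) by (simp add: norm_scaleC mult_left_le_one_le)
  moreover have "cmod (lcoord w (c *\<^sub>C x)) \<le> cmod (lcoord w x)"
    using assms(2) by (simp add: lcoord_scaleC norm_mult mult_left_le_one_le)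
  ultimately show ?thesis using assms(1) by (simp add: tube_def)
qed

text \<open>A unitary matrix that takes a coordinate axis to the direction of \<open>w\<close>
  carries a standard cylinder to the tube. As \<rho> counts multiples of \<open>w\<close>, the
  radius of the standard cylinder is \<open>\<rho> * norm w\<close>.\<close>

lemma holomorphic_cylinder_tube:
  fixes w :: "complex ^ 'n"
  assumes "w \<noteq> 0" "0 < \<rho>" "0 < \<sigma>"
  shows "holomorphic_cylinder (tube w 0 \<rho> \<sigma>)"
proof -
  fix k :: 'n
  define u where "u = inverse (of_real (norm w)) *\<^sub>C w"
  have "norm u = 1" using assms(1) by (simp add: u_def norm_scaleC norm_inverse)
  then obtain A where A: "unitary_matrix A" "A *v axis k 1 = u"
    using exists_unitary_matrix_axis by blast
  have Alin: "A *v (c *\<^sub>C x) = c *\<^sub>C (A *v x)" for c x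
    by (simp add: vec_eq_iff matrix_vector_mult_def scaleC_vec_def scaleC_complex_def sum_distrib_left mult_ac)
  have An: "norm (A *v x) = norm x" for x
  proof -
    have "complex_of_real ((norm (A *v x))\<^sup>2) = complex_of_real ((norm x)\<^sup>2)"
      by (simp only: cinner_self[symmetric] cinner_unitary_matrix[OF A(1)])
    then have "(norm (A *v x))\<^sup>2 = (norm x)\<^sup>2"
      by (simp only: of_real_eq_iff)
    then show ?thesis by simp
  qed
  have w: "w = of_real (norm w) *\<^sub>C (A *v axis k 1)"
    using assms(1) by (simp add: A(2) u_def scaleC_scaleC scaleC_one)
  have l: "lcoord w (A *v z) = z $ k / of_real (norm w)" for z
  proof -
    have "cinner (A *v z) w = cinner (A *v z) (A *v (of_real (norm w) *\<^sub>C axis k 1))"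
      by (subst w) (simp only: Alin)
    also have "\<dots> = of_real (norm w) * z $ k"
      unfolding cinner_unitary_matrix[OF A(1)]
      by (simp add: cinner_vec_def scaleC_vec_def axis_def scaleC_complex_def cinner_complex_def
        if_distrib cong: if_cong)
    finally show ?thesis
      using assms(1) by (simp add: lcoord_def power2_eq_square)
  qed
  have p: "A *v z - lcoord w (A *v z) *\<^sub>C w = A *v (z - z $ k *\<^sub>C axis k 1)" for z
  proof -
    have "lcoord w (A *v z) *\<^sub>C w = z $ k *\<^sub>C u"
      by (simp add: l u_def scaleC_scaleC divide_inverse)
    then show ?thesis by (simp add: matrix_vector_mult_diff_distrib Alin A(2))
  qed
  have n: "(norm (z - z $ k *\<^sub>C axis k 1))\<^sup>2 = (\<Sum>j\<in>UNIV - {k}. (cmod (z $ j))\<^sup>2)" for z :: "complex ^ 'n"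
  proof -
    have "(norm (z - z $ k *\<^sub>C axis k 1))\<^sup>2 = (\<Sum>j\<in>UNIV. (cmod ((z - z $ k *\<^sub>C axis k 1) $ j))\<^sup>2)"
      by (simp add: norm_vec_def L2_set_def sum_nonneg)
    also have "\<dots> = (\<Sum>j\<in>UNIV. if j \<in> UNIV - {k} then (cmod (z $ j))\<^sup>2 else 0)"
      by (intro sum.cong refl) (auto simp: scaleC_vec_def scaleC_complex_def axis_def)
    also have "\<dots> = (\<Sum>j\<in>UNIV - {k}. (cmod (z $ j))\<^sup>2)"
      by (subst sum.inter_restrict[symmetric]) auto
    finally show ?thesis .
  qed
  have sq: "x < y \<longleftrightarrow> x\<^sup>2 < y\<^sup>2" if "0 \<le> x" "0 < y" for x y :: real
    using that by (meson less_imp_le power2_less_imp_less power_strict_mono zero_less_numeral)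
  have iff: "A *v z \<in> tube w 0 \<rho> \<sigma> \<longleftrightarrow> (cmod (z $ k))\<^sup>2 < (\<rho> * norm w)\<^sup>2 \<and>
      (\<Sum>j\<in>UNIV - {k}. (cmod (z $ j))\<^sup>2) < \<sigma>\<^sup>2" for z
  proof -
    have "cmod (lcoord w (A *v z)) < \<rho> \<longleftrightarrow> cmod (z $ k) < \<rho> * norm w"
      using assms(1) by (simp add: l norm_divide pos_divide_less_eq)
    also have "\<dots> \<longleftrightarrow> (cmod (z $ k))\<^sup>2 < (\<rho> * norm w)\<^sup>2"
      using assms by (intro sq) auto
    finally have 1: "cmod (lcoord w (A *v z)) < \<rho> \<longleftrightarrow> (cmod (z $ k))\<^sup>2 < (\<rho> * norm w)\<^sup>2" .
    have "norm (A *v z - lcoord w (A *v z) *\<^sub>C w) < \<sigma> \<longleftrightarrow> (norm (z - z $ k *\<^sub>C axis k 1))\<^sup>2 < \<sigma>\<^sup>2"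
      unfolding p An using assms by (intro sq) auto
    with 1 show ?thesis by (simp add: tube_def n)
  qed
  have "\<exists>z. x = A *v z" for x
  proof -
    have "A *v ((\<chi> i j. cnj (A $ j $ i)) *v x) = x"
      using A(1) by (simp add: unitary_matrix_def matrix_vector_mul_assoc)
    then show ?thesis by metis
  qed
  then have "tube w 0 \<rho> \<sigma> = (\<lambda>z. A *v z) ` {z. (cmod (z $ k))\<^sup>2 < (\<rho> * norm w)\<^sup>2 \<and>
      (\<Sum>j\<in>UNIV - {k}. (cmod (z $ j))\<^sup>2) < \<sigma>\<^sup>2}"
    using iff by (auto simp: image_iff) metis+
  then show ?thesis
    unfolding holomorphic_cylinder_def using A(1) assms
    by (intro exI[of _ A] exI[of _ k] exI[of _ "\<rho> * norm w"] exI[of _ \<sigma>]) auto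
qed

text \<open>The constant does not depend on the thickness \<open>\<sigma>\<close>: the translates of the smaller tube in the
  direction of \<open>w\<close> that cover the larger one are determined by a cover of a disc.\<close>

lemma emeasure_tube_le_sub_tube:
  fixes w :: "complex ^ 'n"
  assumes "w \<noteq> 0" "0 < \<delta>"
  obtains K :: nat where "0 < K"
    "\<And>\<sigma>. emeasure lborel (tube w 0 \<rho> \<sigma>) \<le> of_nat K * emeasure lborel (tube w c \<delta> \<sigma>)"
proof -
  have cover: "cball (0::complex) \<rho> \<subseteq> (\<Union>b\<in>UNIV. ball b \<delta>)" using assms(2) centre_in_ball by blast
  have "\<exists>B. finite B \<and> cball (0::complex) \<rho> \<subseteq> (\<Union>b\<in>B. ball b \<delta>)"
    by (rule compactE_image[OF compact_cball open_ball cover]) (intro exI conjI, assumption, assumption)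
  then obtain B where B: "finite B" "cball (0::complex) \<rho> \<subseteq> (\<Union>b\<in>B. ball b \<delta>)"
    by blast
  have tr: "emeasure lborel (tube w b \<delta> \<sigma>) = emeasure lborel (tube w c \<delta> \<sigma>)" for b \<sigma>
  proof -
    have "(\<integral>\<^sup>+x. indicator (tube w b \<delta> \<sigma>) ((b - c) *\<^sub>C w + x) \<partial>lborel) =
        (\<integral>\<^sup>+x. indicator (tube w b \<delta> \<sigma>) x \<partial>lborel)"
      by (rule nn_integral_lborel_translate) (simp add: open_tube)
    moreover have "(b - c) *\<^sub>C w + x \<in> tube w b \<delta> \<sigma> \<longleftrightarrow> x \<in> tube w c \<delta> \<sigma>" for x
      using assms(1) by (simp add: tube_def lcoord_add lcoord_scaleC lcoord_self scaleC_add_left)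
    then have "indicator (tube w b \<delta> \<sigma>) ((b - c) *\<^sub>C w + x) = (indicator (tube w c \<delta> \<sigma>) x :: ennreal)" for x
      by (simp add: indicator_def)
    ultimately show ?thesis by (simp add: open_tube)
  qed
  show thesis
  proof
    \<comment> \<open>The successor keeps the constant positive even if the cover \<open>B\<close>
      is empty, which can happen for negative \<rho>.\<close>
    show "0 < Suc (card B)" by simp
    show "emeasure lborel (tube w 0 \<rho> \<sigma>) \<le> of_nat (Suc (card B)) * emeasure lborel (tube w c \<delta> \<sigma>)" for \<sigma>
    proof -
      have "tube w 0 \<rho> \<sigma> \<subseteq> (\<Union>b\<in>B. tube w b \<delta> \<sigma>)"
      proof
        fix x assume x: "x \<in> tube w 0 \<rho> \<sigma>"
        then have "lcoord w x \<in> cball 0 \<rho>" by (simp add: tube_def)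
        then obtain b where "b \<in> B" "lcoord w x \<in> ball b \<delta>" using B(2) by blast
        with x show "x \<in> (\<Union>b\<in>B. tube w b \<delta> \<sigma>)"
          by (auto simp: tube_def dist_norm norm_minus_commute)
      qed
      then have "emeasure lborel (tube w 0 \<rho> \<sigma>) \<le> emeasure lborel (\<Union>b\<in>B. tube w b \<delta> \<sigma>)"
        by (intro emeasure_mono) (auto intro!: borel_open open_UN open_tube)
      also have "\<dots> \<le> (\<Sum>b\<in>B. emeasure lborel (tube w b \<delta> \<sigma>))"
        using B(1) by (intro emeasure_subadditive_finite) (auto intro!: borel_open open_tube)
      also have "\<dots> = (\<Sum>b\<in>B. emeasure lborel (tube w c \<delta> \<sigma>))"
        by (intro sum.cong refl tr)
      also have "\<dots> = of_nat (card B) * emeasure lborel (tube w c \<delta> \<sigma>)"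
        by simp
      also have "\<dots> \<le> of_nat (Suc (card B)) * emeasure lborel (tube w c \<delta> \<sigma>)"
        by (intro mult_right_mono) auto
      finally show ?thesis .
    qed
  qed
qed

section \<open>Mean values over cylinders\<close>

lemma bounded_bilinear_scaleC:
  "bounded_bilinear (\<lambda>c (x::'a::complex_normed_vector). c *\<^sub>C x)"
  by (rule bounded_bilinear.intro)
    (auto simp: scaleC_add_left scaleC_add_right scaleR_scaleC scaleC_scaleC scaleC_complex_def
      mult.commute norm_scaleC intro!: exI[of _ 1])

lemma continuous_on_holomorphic_map: "holomorphic_map_on F U \<Longrightarrow> continuous_on U F"
  unfolding holomorphic_map_on_def
  by (meson continuous_at_imp_continuous_on has_derivative_continuous)

lemma holomorphic_on_slice:
  assumes "holomorphic_map_on F U"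
  shows "(\<lambda>t. F (a + t *\<^sub>C y)) holomorphic_on {t. a + t *\<^sub>C y \<in> U}"
  unfolding holomorphic_on_def
proof
  fix t assume "t \<in> {t. a + t *\<^sub>C y \<in> U}"
  then obtain F' where F': "(F has_derivative F') (at (a + t *\<^sub>C y))" "\<And>c v. F' (c *\<^sub>C v) = c *\<^sub>C F' v"
    using assms by (auto simp: holomorphic_map_on_def)
  have "((\<lambda>t. a + t *\<^sub>C y) has_derivative (\<lambda>t. t *\<^sub>C y)) (at t)"
    using bounded_linear_imp_has_derivative[OF bounded_linear_scaleC_left]
    by (auto intro!: derivative_eq_intros)
  then have "((\<lambda>t. F (a + t *\<^sub>C y)) has_derivative (\<lambda>t. F' (t *\<^sub>C y))) (at t)"
    using has_derivative_compose F'(1) by blast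
  then have "((\<lambda>t. F (a + t *\<^sub>C y)) has_field_derivative F' y) (at t)"
    by (simp add: has_field_derivative_def F'(2) scaleC_complex_def mult.commute[of _ "F' y"])
  then show "(\<lambda>t. F (a + t *\<^sub>C y)) field_differentiable at t within {t. a + t *\<^sub>C y \<in> U}"
    using field_differentiable_at_within field_differentiable_def by blast
qed

text \<open>For each \<open>x\<close> in \<open>P\<close> the disc of all
  \<open>z + t *\<^sub>C x\<close> with \<open>cmod t \<le> 1\<close> lies in the translate, so the
  one-variable submean inequality holds on its boundary. Integration over \<open>x\<close> and
  Fubini leave, for each angle, an integral over a rotated copy of \<open>P\<close>; rotations
  preserve the measure, so all angles contribute equally and the factor \<open>2 * pi\<close>
  cancels.\<close>

lemma nn_integral_cmod_powr_submean:
  fixes F :: "complex ^ 'n \<Rightarrow> complex"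
  assumes hol: "holomorphic_map_on F ((+) z ` P)" and P: "open P"
    and balanced: "\<And>c x. x \<in> P \<Longrightarrow> cmod c \<le> 1 \<Longrightarrow> c *\<^sub>C x \<in> P" and \<alpha>: "0 < \<alpha>"
  shows "ennreal (cmod (F z) powr \<alpha>) * emeasure lborel P
    \<le> (\<integral>\<^sup>+y\<in>(+) z ` P. ennreal (cmod (F y) powr \<alpha>) \<partial>lborel)"
proof -
  define Q where "Q = (+) z ` P"
  have Q: "open Q" unfolding Q_def using P by (rule open_translation)
  have inQ: "z + x \<in> Q \<longleftrightarrow> x \<in> P" for x by (auto simp: Q_def)
  have [measurable]: "P \<in> sets borel" "Q \<in> sets borel" using P Q by auto
  define G where "G y = ennreal (cmod (if y \<in> Q then F y else 0) powr \<alpha>)" for y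
  have [measurable]: "(\<lambda>y. if y \<in> Q then F y else 0) \<in> borel_measurable borel"
    using continuous_on_holomorphic_map[OF hol] Q
    by (intro borel_measurable_continuous_on_if) (auto simp: Q_def)
  have [measurable]: "G \<in> borel_measurable borel" unfolding G_def by measurable
  define H where "H x = G (z + x)" for x
  have [measurable]: "H \<in> borel_measurable borel" unfolding H_def by measurable
  have "continuous_on UNIV (\<lambda>q. cis (fst q) *\<^sub>C (snd q :: complex ^ 'n))"
    by (intro bounded_bilinear.continuous_on[OF bounded_bilinear_scaleC] continuous_intros)
  then have "(\<lambda>q. cis (fst q) *\<^sub>C (snd q :: complex ^ 'n)) \<in> borel_measurable borel"
    by (rule borel_measurable_continuous_onI)
  then have [measurable]: "(\<lambda>q. cis (fst q) *\<^sub>C (snd q :: complex ^ 'n)) \<in> borel_measurable (borel \<Otimes>\<^sub>M borel)"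
    by (simp only: borel_prod)
  have circ: "ennreal (2 * pi * cmod (F z) powr \<alpha>) * indicator P x
      \<le> (\<integral>\<^sup>+t. indicator {0..2 * pi} t * H (cis t *\<^sub>C x) \<partial>lborel)" for x
  proof (cases "x \<in> P")
    case True
    have "ennreal (2 * pi * cmod (F (z + 0 *\<^sub>C x)) powr \<alpha>)
        \<le> (\<integral>\<^sup>+t. indicator {0..2 * pi} t * ennreal (cmod (F (z + cis t *\<^sub>C x)) powr \<alpha>) \<partial>lborel)"
    proof (rule circle_mean_cmod_powr[OF holomorphic_on_slice[OF hol] _ _ \<alpha>])
      have "continuous_on UNIV (\<lambda>t. z + t *\<^sub>C x)"
        by (intro continuous_intros bounded_bilinear.continuous_on[OF bounded_bilinear_scaleC])
      then have "open ((\<lambda>t. z + t *\<^sub>C x) -` Q)"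
        using Q by (simp add: open_vimage)
      then show "open {t. z + t *\<^sub>C x \<in> (+) z ` P}"
        by (simp add: vimage_def Q_def)
      show "cball 0 1 \<subseteq> {t. z + t *\<^sub>C x \<in> (+) z ` P}"
        using balanced[OF True] by (auto simp: inQ[unfolded Q_def])
    qed
    moreover have "H (cis t *\<^sub>C x) = ennreal (cmod (F (z + cis t *\<^sub>C x)) powr \<alpha>)" for t
      using balanced[OF True] by (simp add: H_def G_def inQ)
    ultimately show ?thesis
      using True by (simp add: scaleC_zero_left)
  qed simp
  have [measurable]: "(\<lambda>x::complex ^ 'n. c *\<^sub>C x) \<in> borel_measurable borel" for c
    by (intro borel_measurable_continuous_onI linear_continuous_on bounded_linear_scaleC_right)
  have rot: "(\<integral>\<^sup>+x. H (cis t *\<^sub>C x) \<partial>lborel) = (\<integral>\<^sup>+x. H x \<partial>lborel)" for t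
  proof (rule nn_integral_lborel_orthogonal_transformation)
    show "orthogonal_transformation (\<lambda>x::complex ^ 'n. cis t *\<^sub>C x)"
      by (simp add: orthogonal_transformation norm_scaleC bounded_linear.linear bounded_linear_scaleC_right)
  qed measurable
  have "ennreal (2 * pi) * (ennreal (cmod (F z) powr \<alpha>) * emeasure lborel P)
      = (\<integral>\<^sup>+x. ennreal (2 * pi * cmod (F z) powr \<alpha>) * indicator P x \<partial>lborel)"
    by (subst nn_integral_cmult_indicator) (simp_all add: P ennreal_mult mult.assoc)
  also have "\<dots> \<le> (\<integral>\<^sup>+x. (\<integral>\<^sup>+t. indicator {0..2 * pi} t * H (cis t *\<^sub>C x) \<partial>lborel) \<partial>lborel)"
    by (intro nn_integral_mono circ)
  also have "\<dots> = (\<integral>\<^sup>+t. (\<integral>\<^sup>+x. indicator {0..2 * pi} t * H (cis t *\<^sub>C x) \<partial>lborel) \<partial>lborel)"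
  proof (rule lborel_pair.Fubini')
    have "(\<lambda>q. indicator {0..2 * pi} (fst q) * H (cis (fst q) *\<^sub>C snd q)) \<in> borel_measurable (borel \<Otimes>\<^sub>M borel)"
      by measurable
    then show "(\<lambda>(t, x). indicator {0..2 * pi} t * H (cis t *\<^sub>C x)) \<in> borel_measurable (lborel \<Otimes>\<^sub>M lborel)"
      by (simp add: split_beta)
  qed
  also have "\<dots> = (\<integral>\<^sup>+t. indicator {0..2 * pi} t * (\<integral>\<^sup>+x. H x \<partial>lborel) \<partial>lborel)"
    by (intro nn_integral_cong) (simp add: nn_integral_cmult rot)
  also have "\<dots> = ennreal (2 * pi) * (\<integral>\<^sup>+x. H x \<partial>lborel)"
    by (simp add: nn_integral_multc)
  finally have "ennreal (cmod (F z) powr \<alpha>) * emeasure lborel P \<le> (\<integral>\<^sup>+x. H x \<partial>lborel)"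
    by (subst (asm) ennreal_mult_le_mult_iff) auto
  also have "\<dots> = (\<integral>\<^sup>+y. G y \<partial>lborel)"
    unfolding H_def by (rule nn_integral_lborel_translate) measurable
  also have "\<dots> = (\<integral>\<^sup>+y\<in>Q. ennreal (cmod (F y) powr \<alpha>) \<partial>lborel)"
    by (intro nn_integral_cong) (simp add: G_def)
  finally show ?thesis by (simp only: Q_def)
qed

lemma holomorphic_map_on_mult:
  fixes f g :: "'a::complex_normed_vector \<Rightarrow> complex"
  assumes "holomorphic_map_on f U" "holomorphic_map_on g U"
  shows "holomorphic_map_on (\<lambda>x. f x * g x) U"
  unfolding holomorphic_map_on_def
proof
  fix x assume "x \<in> U"
  then obtain f' g' where f': "(f has_derivative f') (at x)" "\<And>c v. f' (c *\<^sub>C v) = c *\<^sub>C f' v"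
    and g': "(g has_derivative g') (at x)" "\<And>c v. g' (c *\<^sub>C v) = c *\<^sub>C g' v"
    using assms unfolding holomorphic_map_on_def by metis
  show "\<exists>k. ((\<lambda>x. f x * g x) has_derivative k) (at x) \<and> (\<forall>c v. k (c *\<^sub>C v) = c *\<^sub>C k v)"
    using has_derivative_mult[OF f'(1) g'(1)]
    by (intro exI conjI) (assumption, simp add: f'(2) g'(2) scaleC_complex_def algebra_simps)
qed

text \<open>In a trivialization the pairing is the evaluation of an operator-valued holomorphic map
  at a vector-valued one, to which the product rule for bounded bilinear maps applies.\<close>

lemma holomorphic_map_on_dual_pairing:
  fixes E :: "('e, 'n::finite, 'f::complex_hilbert) vbundle"
  assumes E: "holomorphic_vector_bundle D E" and U: "U \<subseteq> D"
    and s: "holomorphic_dual_section E U s" and Q: "Q \<subseteq> U" "holomorphic_section E Q f"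
    and "open Q"
  shows "holomorphic_map_on (\<lambda>x. s x (f x)) Q"
  unfolding holomorphic_map_on_def
proof
  fix x assume x: "x \<in> Q"
  then have "x \<in> D" using U Q by blast
  then obtain V \<phi> where V: "(V, \<phi>) \<in> trivs E" "x \<in> V"
    using E by (auto simp: holomorphic_vector_bundle_def)
  have bij: "bij_betw \<phi> (fibre E x) UNIV"
    and sc: "\<And>c v. v \<in> fibre E x \<Longrightarrow> fscale E c v \<in> fibre E x \<and> \<phi> (fscale E c v) = c *\<^sub>C \<phi> v"
    and "open V"
    using E V unfolding holomorphic_vector_bundle_def by blast+
  obtain L :: "complex ^ 'n \<Rightarrow> ('f \<Rightarrow>\<^sub>L complex)" where L: "holomorphic_map_on L (U \<inter> V)"
    "\<And>x v. x \<in> U \<inter> V \<Longrightarrow> v \<in> fibre E x \<Longrightarrow> s x v = blinfun_apply (L x) (\<phi> v)"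
    using s V(1) unfolding holomorphic_dual_section_def by blast
  have f: "\<And>x. x \<in> Q \<Longrightarrow> f x \<in> fibre E x" "holomorphic_map_on (\<lambda>x. \<phi> (f x)) (Q \<inter> V)"
    using Q(2) V(1) unfolding holomorphic_section_def by auto
  have xUV: "x \<in> U \<inter> V" and xQV: "x \<in> Q \<inter> V" using x V Q by auto
  obtain L' where L': "(L has_derivative L') (at x)" "\<And>c v. L' (c *\<^sub>C v) = c *\<^sub>C L' v"
    using L(1) xUV unfolding holomorphic_map_on_def by blast
  obtain f' where f': "((\<lambda>x. \<phi> (f x)) has_derivative f') (at x)" "\<And>c v. f' (c *\<^sub>C v) = c *\<^sub>C f' v"
    using f(2) xQV unfolding holomorphic_map_on_def by blast
  \<comment> \<open>The type of \<open>L x\<close> guarantees only real linearity. Complex linearity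
    is recovered from the functional \<open>s x\<close>, since \<phi> maps the fibre onto the model
    space.\<close>
  have Llin: "blinfun_apply (L x) (c *\<^sub>C v) = c *\<^sub>C blinfun_apply (L x) v" for c v
  proof -
    obtain e where e: "e \<in> fibre E x" "\<phi> e = v"
      using bij by (metis UNIV_I bij_betw_imp_surj_on imageE)
    have "s x (fscale E c e) = c * s x e"
      using s x Q(1) e(1) unfolding holomorphic_dual_section_def dual_fibre_def by blast
    then show ?thesis
      using L(2)[OF xUV] sc[OF e(1), of c] e by (simp add: scaleC_complex_def)
  qed
  have "((\<lambda>x. blinfun_apply (L x) (\<phi> (f x))) has_derivative
      (\<lambda>v. blinfun_apply (L x) (f' v) + blinfun_apply (L' v) (\<phi> (f x)))) (at x)"
    by (rule bounded_bilinear.FDERIV[OF bounded_bilinear_blinfun_apply L'(1) f'(1)])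
  then have "((\<lambda>x. s x (f x)) has_derivative
      (\<lambda>v. blinfun_apply (L x) (f' v) + blinfun_apply (L' v) (\<phi> (f x)))) (at x)"
  proof (rule has_derivative_transform_within_open)
    show "open (Q \<inter> V)" using \<open>open Q\<close> \<open>open V\<close> by blast
    show "blinfun_apply (L y) (\<phi> (f y)) = s y (f y)" if "y \<in> Q \<inter> V" for y
      using L(2)[of y "f y"] f(1)[of y] that Q(1) by auto
  qed (rule xQV)
  then show "\<exists>k. ((\<lambda>x. s x (f x)) has_derivative k) (at x) \<and> (\<forall>c v. k (c *\<^sub>C v) = c *\<^sub>C k v)"
    by (intro exI conjI allI) (assumption, simp add: f'(2) L'(2) Llin blinfun_apply_scaleC scaleC_add_right)
qed

section \<open>Fibrewise duality between the Finsler norm and the dual norm\<close>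

lemma holomorphic_vector_bundle_fibreD:
  assumes E: "holomorphic_vector_bundle D E" and x: "x \<in> D"
  shows "fzero E x \<in> fibre E x"
    and "v \<in> fibre E x \<Longrightarrow> fscale E c v \<in> fibre E x"
    and "v \<in> fibre E x \<Longrightarrow> fscale E 0 v = fzero E x"
proof -
  obtain V \<phi> where V: "(V, \<phi>) \<in> trivs E" "x \<in> V"
    using E x by (auto simp: holomorphic_vector_bundle_def)
  have bij: "bij_betw \<phi> (fibre E x) UNIV"
    and z: "fzero E x \<in> fibre E x" "\<phi> (fzero E x) = 0"
    and sc: "\<And>c v. v \<in> fibre E x \<Longrightarrow> fscale E c v \<in> fibre E x \<and> \<phi> (fscale E c v) = c *\<^sub>C \<phi> v"
    using E V unfolding holomorphic_vector_bundle_def by blast+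
  show "fzero E x \<in> fibre E x" by (rule z)
  show "fscale E c v \<in> fibre E x" if "v \<in> fibre E x"
    using sc[OF that] by blast
  show "fscale E 0 v = fzero E x" if "v \<in> fibre E x"
    using bij sc[OF that, of 0] z by (auto simp: bij_betw_def inj_on_def scaleC_zero_left)
qed

lemma finsler_norm_fscale:
  assumes h: "singular_finsler_metric E h" and v: "v \<in> total E" "finsler_norm h v < \<infinity>"
  shows "finsler_norm h (fscale E c v) = ennreal (cmod c) * finsler_norm h v"
proof -
  have "h v < \<infinity>"
    using v(2) by (auto simp: finsler_norm_def ennreal_powr_def less_top split: if_splits)
  then obtain x where x: "h v = ennreal x" "0 \<le> x" by (cases "h v") auto
  have "h (fscale E c v) = ennreal ((cmod c)\<^sup>2 * x)"
    using h v(1) x by (simp add: singular_finsler_metric_def ennreal_mult)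
  then show ?thesis
    using x by (simp add: finsler_norm_def ennreal_powr_def powr_half_sqrt real_sqrt_mult flip: ennreal_mult)
qed

lemma cmod_le_dual_norm_mult_finsler_norm:
  assumes E: "holomorphic_vector_bundle D E" and h: "singular_finsler_metric E h" and x: "x \<in> D"
    and \<xi>: "\<xi> \<in> dual_fibre E x" and fin: "dual_norm E h x \<xi> < \<infinity>"
    and v: "v \<in> fibre E x" "finsler_norm h v < \<infinity>"
  shows "ennreal (cmod (\<xi> v)) \<le> dual_norm E h x \<xi> * finsler_norm h v"
proof -
  note F = holomorphic_vector_bundle_fibreD[OF E x]
  have vt: "v \<in> total E" using v(1) by (simp add: fibre_def)
  have sc: "\<xi> (fscale E c v) = c * \<xi> v" for c
    using \<xi> v(1) by (simp add: dual_fibre_def)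
  show ?thesis
  \<comment> \<open>A nonzero vector of finite length selects the supremum branch in
    \<open>dual_norm\<close>; the zero vector gives no such information, but there the functional
    vanishes.\<close>
  proof (cases "v = fzero E x")
    case True
    then have "\<xi> v = 0" using sc[of 0] F(3)[OF v(1)] by simp
    then show ?thesis by simp
  next
    case False
    obtain N where N: "dual_norm E h x \<xi> = ennreal N" "0 \<le> N"
      using fin by (cases "dual_norm E h x \<xi>") auto
    obtain l where l: "finsler_norm h v = ennreal l" "0 \<le> l"
      using v(2) by (cases "finsler_norm h v") auto
    \<comment> \<open>Stated with a multiplier \<open>r\<close> and not with division by
      \<open>l\<close>, since \<open>l\<close> may be 0. In that case every \<open>r\<close> is
      admissible, and a nonzero value of the functional would exceed the finite
      \<open>N\<close>.\<close>
    have bound: "r * cmod (\<xi> v) \<le> N" if "0 \<le> r" "r * l \<le> 1" for r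
    proof -
      have "finsler_norm h (fscale E (of_real r) v) \<le> 1"
        using that l by (simp add: finsler_norm_fscale[OF h vt v(2)] flip: ennreal_mult)
      then have "ennreal (cmod (\<xi> (fscale E (of_real r) v))) \<le> dual_norm E h x \<xi>"
        unfolding dual_norm_def using False v F(2)[OF v(1)] by (auto intro: SUP_upper2)
      then show ?thesis
        using that N by (simp add: sc norm_mult)
    qed
    have "cmod (\<xi> v) \<le> N * l"
    proof (cases "l = 0")
      case True
      have "cmod (\<xi> v) = 0"
      proof (rule ccontr)
        assume "cmod (\<xi> v) \<noteq> 0"
        moreover have "((N + 1) / cmod (\<xi> v)) * cmod (\<xi> v) \<le> N"
          using N by (intro bound) (auto simp: True)
        ultimately show False by simp
      qed
      then show ?thesis using True by simp
    next
      case False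
      then have "(1 / l) * cmod (\<xi> v) \<le> N"
        using l by (intro bound) auto
      then show ?thesis using False l by (simp add: pos_divide_le_eq)
    qed
    then show ?thesis using N l by (simp flip: ennreal_mult)
  qed
qed

text \<open>The extension condition starts from vectors of length exactly 1, whereas the supremum
  runs over length at most 1. A vector with a value above \<open>t\<close> cannot have length 0, by
  the pairing inequality and finiteness of the dual norm, and normalizing it only increases the
  value.\<close>

lemma exists_unit_vector_near_dual_norm:
  assumes E: "holomorphic_vector_bundle D E" and h: "singular_finsler_metric E h" and x: "x \<in> D"
    and \<xi>: "\<xi> \<in> dual_fibre E x" and fin: "dual_norm E h x \<xi> < \<infinity>"
    and t: "0 \<le> t" "ennreal t < dual_norm E h x \<xi>"
  obtains a where "a \<in> fibre E x" "finsler_norm h a = 1" "t < cmod (\<xi> a)"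
proof -
  note F = holomorphic_vector_bundle_fibreD[OF E x]
  obtain v where v: "v \<in> fibre E x" "finsler_norm h v \<le> 1" "ennreal t < ennreal (cmod (\<xi> v))"
    using t(2) by (auto simp: dual_norm_def less_SUP_iff split: if_splits)
  have tv: "t < cmod (\<xi> v)" using v(3) t(1) by (simp add: ennreal_less_iff)
  have vfin: "finsler_norm h v < \<infinity>" using v(2) by (rule le_less_trans) simp
  obtain l where l: "finsler_norm h v = ennreal l" "0 \<le> l"
    using vfin by (cases "finsler_norm h v") auto
  have "l \<noteq> 0"
    using cmod_le_dual_norm_mult_finsler_norm[OF E h x \<xi> fin v(1) vfin] l tv t(1) by auto
  have l1: "0 < l" "l \<le> 1" using v(2) l \<open>l \<noteq> 0\<close> by auto
  have vt: "v \<in> total E" using v(1) by (simp add: fibre_def)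
  show thesis
  proof
    show "fscale E (of_real (1 / l)) v \<in> fibre E x" by (rule F(2)[OF v(1)])
    show "finsler_norm h (fscale E (of_real (1 / l)) v) = 1"
      unfolding finsler_norm_fscale[OF h vt vfin] using l l1 by (simp flip: ennreal_mult del: of_real_divide)
    have "\<xi> (fscale E (of_real (1 / l)) v) = of_real (1 / l) * \<xi> v"
      using \<xi> v(1) by (simp add: dual_fibre_def)
    then have "cmod (\<xi> (fscale E (of_real (1 / l)) v)) = cmod (\<xi> v) / l"
      using l1 by (simp add: norm_divide)
    moreover have "cmod (\<xi> v) \<le> cmod (\<xi> v) / l"
      using l1 by (simp add: pos_le_divide_eq mult_left_le)
    ultimately show "t < cmod (\<xi> (fscale E (of_real (1 / l)) v))" using tv by simp
  qed
qed

text \<open>The supremum defining the dual norm at the centre need not be attained, hence the number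
  \<open>t\<close> strictly below it. Cauchy-Schwarz is applied to \<open>A\<close> and
  \<open>B\<close>: the square of \<open>A\<close> is the integrand on the right, the square of
  \<open>B\<close> has integral at most the volume, and \<open>A * B\<close> dominates the (p/2)-th
  power of the modulus of the holomorphic function \<open>k * g\<close> almost everywhere.\<close>

lemma dual_norm_submean_weak:
  fixes E :: "('e, 'n::finite, 'f::complex_hilbert) vbundle"
  assumes E: "holomorphic_vector_bundle D E" and h: "singular_finsler_metric E h"
    and p: "0 < p" and ext: "optimal_Lp_extension D E h p"
    and UD: "U \<subseteq> D" and s: "holomorphic_dual_section E U s"
    and usc: "usc_on U (\<lambda>x. dual_norm E h x (s x))"
    and T: "holomorphic_cylinder T" "open T" "0 \<in> T" "emeasure lborel T < \<infinity>"
      "\<And>c x. x \<in> T \<Longrightarrow> cmod c \<le> 1 \<Longrightarrow> c *\<^sub>C x \<in> T"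
    and Q: "(+) z ` T \<subseteq> U" and \<kappa>: "holomorphic_map_on \<kappa> ((+) z ` T)"
    and t: "0 \<le> t" "ennreal t < dual_norm E h z (s z)"
  shows "ennreal ((cmod (\<kappa> z) * t) powr p) * emeasure lborel T
    \<le> (\<integral>\<^sup>+y\<in>(+) z ` T. ennreal ((cmod (\<kappa> y) * enn2real (dual_norm E h y (s y))) powr p) \<partial>lborel)"
proof -
  define Q where "Q = (+) z ` T"
  have QU: "Q \<subseteq> U" and openQ: "open Q" and zQ: "z \<in> Q"
    using \<open>(+) z ` T \<subseteq> U\<close> T(2,3) by (auto simp: Q_def intro: open_translation)
  have [measurable]: "Q \<in> sets borel" using openQ by simp
  have QD: "y \<in> D" if "y \<in> Q" for y using QU UD that by blast
  have sdual: "s y \<in> dual_fibre E y" if "y \<in> Q" for y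
    using s QU that by (auto simp: holomorphic_dual_section_def)
  have fin: "dual_norm E h y (s y) < \<infinity>" if "y \<in> Q" for y
    using usc QU that by (auto simp: usc_on_def)
  obtain a where a: "a \<in> fibre E z" "finsler_norm h a = 1" "t < cmod (s z a)"
    using exists_unit_vector_near_dual_norm[OF E h QD[OF zQ] sdual[OF zQ] fin[OF zQ] t] by blast
  have "Q \<subseteq> D" using QD by blast
  then obtain f where f: "holomorphic_section E Q f" "f z = a"
    and int: "(\<integral>\<^sup>+y\<in>Q. ennreal_powr (finsler_norm h (f y)) p \<partial>lebesgue) / emeasure lebesgue T \<le> 1"
    using ext QD[OF zQ] a T(1) unfolding optimal_Lp_extension_def Q_def by blast
  have fib: "f y \<in> fibre E y" if "y \<in> Q" for y
    using f(1) that by (simp add: holomorphic_section_def)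
  \<comment> \<open>Extension by 0 outside the open set \<open>Q\<close> gives globally Borel
    functions, as all three are continuous or upper semicontinuous on \<open>Q\<close>.\<close>
  define N where "N y = (if y \<in> Q then dual_norm E h y (s y) else 0)" for y
  define g where "g y = (if y \<in> Q then s y (f y) else 0)" for y
  define k where "k y = (if y \<in> Q then \<kappa> y else 0)" for y
  have holg: "holomorphic_map_on (\<lambda>y. s y (f y)) Q"
    by (rule holomorphic_map_on_dual_pairing[OF E UD s QU f(1) openQ])
  have [measurable]: "g \<in> borel_measurable borel" "k \<in> borel_measurable borel"
    unfolding g_def k_def using continuous_on_holomorphic_map[OF holg]
      continuous_on_holomorphic_map[OF \<kappa>, folded Q_def]
    by (auto intro!: borel_measurable_continuous_on_if)
  have [measurable]: "N \<in> borel_measurable borel"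
  proof (rule borel_measurableI_less)
    fix c
    obtain V where V: "open V" "{x \<in> U. dual_norm E h x (s x) < c} = U \<inter> V"
      using usc unfolding usc_on_def openin_open by blast
    have "{y \<in> space borel. N y < c} = (Q \<inter> V) \<union> (if 0 < c then - Q else {})"
    proof (intro set_eqI)
      fix y
      have "y \<in> {x \<in> U. dual_norm E h x (s x) < c} \<longleftrightarrow> y \<in> U \<inter> V" by (simp only: V(2))
      then show "y \<in> {y \<in> space borel. N y < c} \<longleftrightarrow> y \<in> (Q \<inter> V) \<union> (if 0 < c then - Q else {})"
        using QU by (auto simp: N_def)
    qed
    moreover have "(Q \<inter> V) \<union> (if 0 < c then - Q else {}) \<in> sets borel"
      using V(1) openQ by auto
    ultimately show "{y \<in> space borel. N y < c} \<in> sets borel" by simp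
  qed
  define A where "A y = ennreal ((cmod (k y) * enn2real (N y)) powr (p / 2))" for y
  \<comment> \<open>\<open>h\<close> need not be measurable, so the hypothesis only bounds a lower integral; it is used
    through the measurable minorant \<open>B\<^sup>2\<close>, that is \<open>(cmod g / N) powr p\<close> with \<open>0 / 0 = 0\<close> and
    \<open>x / 0 = \<infinity>\<close> otherwise.\<close>
  define B where "B y = (if N y = 0 then (if g y = 0 then 0 else \<infinity>)
    else ennreal ((cmod (g y) / enn2real (N y)) powr (p / 2)))" for y
  have [measurable]: "A \<in> borel_measurable borel" "B \<in> borel_measurable borel"
    unfolding A_def B_def by measurable
  have sq: "(ennreal (x powr (p / 2)))\<^sup>2 = ennreal (x powr p)" for x
    by (simp add: power2_eq_square flip: ennreal_mult powr_add)
  have pairing: "ennreal (cmod (g y)) \<le> N y * finsler_norm h (f y)"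
    if "y \<in> Q" "finsler_norm h (f y) < \<infinity>" for y
    using cmod_le_dual_norm_mult_finsler_norm[OF E h QD sdual fin fib] that
    by (simp add: N_def g_def)
  have Ble: "(B y)\<^sup>2 \<le> ennreal_powr (finsler_norm h (f y)) p * indicator Q y" for y
  proof (cases "y \<in> Q")
    case False
    then show ?thesis by (simp add: B_def N_def g_def)
  next
    case True
    show ?thesis
    proof (cases "finsler_norm h (f y)")
      case top
      then show ?thesis using True by (simp add: ennreal_powr_def)
    next
      case (real l)
      have gl: "ennreal (cmod (g y)) \<le> N y * ennreal l"
        using pairing[OF True] real by simp
      obtain m where m: "N y = ennreal m" "0 \<le> m"
        using fin[OF True] True by (cases "N y") (auto simp: N_def)
      have gl': "cmod (g y) \<le> m * l"
        using gl m real by (simp flip: ennreal_mult)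
      show ?thesis
      proof (cases "m = 0")
        case m0: True
        then have "g y = 0" using gl' by simp
        then show ?thesis using m m0 by (simp add: B_def)
      next
        case False
        then have "cmod (g y) / m \<le> l"
          using gl' m by (simp add: pos_divide_le_eq mult.commute)
        then have "(cmod (g y) / m) powr p \<le> l powr p"
          using m p by (intro powr_mono2) auto
        then show ?thesis
          using True real m False by (simp add: B_def ennreal_powr_def sq)
      qed
    qed
  qed
  have leb: "emeasure lebesgue T = emeasure lborel T" using T(2) by simp
  have Tpos: "emeasure lborel T \<noteq> 0"
    using T(2,3) by (intro emeasure_lborel_open_nonzero) auto
  have "(\<integral>\<^sup>+y. (B y)\<^sup>2 \<partial>lborel) \<le> (\<integral>\<^sup>+y\<in>Q. ennreal_powr (finsler_norm h (f y)) p \<partial>lebesgue)"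
    unfolding nn_integral_completion by (intro nn_integral_mono Ble)
  also have "\<dots> \<le> emeasure lborel T"
  proof -
    define X where "X = (\<integral>\<^sup>+y\<in>Q. ennreal_powr (finsler_norm h (f y)) p \<partial>lebesgue)"
    have "X = (X / emeasure lborel T) * emeasure lborel T"
      using Tpos T(4) by (simp add: ennreal_divide_times)
    also have "\<dots> \<le> 1 * emeasure lborel T"
      using int unfolding X_def leb by (intro mult_right_mono) auto
    finally show ?thesis by (simp add: X_def)
  qed
  finally have B2: "(\<integral>\<^sup>+y. (B y)\<^sup>2 \<partial>lborel) \<le> emeasure lborel T" .
  \<comment> \<open>Where \<open>N\<close> vanishes but \<open>g\<close> does not, the extension has
    infinite length and \<open>A * B\<close> would be 0. The finite integral confines such points to
    a null set.\<close>
  have "AE y in lborel. (B y)\<^sup>2 \<noteq> \<infinity>"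
    using B2 T(4) by (intro nn_integral_noteq_infinite) auto
  then have AEle: "AE y in lborel. ennreal (cmod (k y * g y) powr (p / 2)) \<le> A y * B y"
  proof eventually_elim
    case (elim y)
    show ?case
    proof (cases "N y = 0")
      case True
      then have "g y = 0" using elim by (auto simp: B_def split: if_splits)
      then show ?thesis by simp
    next
      case False
      have "N y < \<infinity>" using fin by (simp add: N_def)
      with False have "0 < enn2real (N y)" by (simp add: enn2real_positive_iff less_top zero_less_iff_neq_zero)
      then have n: "0 \<le> cmod (g y) / enn2real (N y)"
        and kg: "(cmod (k y) * enn2real (N y)) * (cmod (g y) / enn2real (N y)) = cmod (k y * g y)"
        by (simp_all add: norm_mult)
      have "A y * B y = ennreal ((cmod (k y) * enn2real (N y)) powr (p / 2)
          * (cmod (g y) / enn2real (N y)) powr (p / 2))"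
        using False by (simp add: A_def B_def ennreal_mult)
      also have "\<dots> = ennreal (cmod (k y * g y) powr (p / 2))"
        by (simp only: kg flip: powr_mult)
      finally show ?thesis by simp
    qed
  qed
  have "ennreal (cmod (\<kappa> z * s z (f z)) powr (p / 2)) * emeasure lborel T
      \<le> (\<integral>\<^sup>+y\<in>(+) z ` T. ennreal (cmod (\<kappa> y * s y (f y)) powr (p / 2)) \<partial>lborel)"
    using holomorphic_map_on_mult[OF \<kappa> holg[unfolded Q_def]] T p
    by (intro nn_integral_cmod_powr_submean) auto
  also have "\<dots> = (\<integral>\<^sup>+y. ennreal (cmod (k y * g y) powr (p / 2)) \<partial>lborel)"
    by (intro nn_integral_cong) (auto simp: k_def g_def Q_def indicator_def)
  also have "\<dots> \<le> (\<integral>\<^sup>+y. A y * B y \<partial>lborel)"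
    by (rule nn_integral_mono_AE[OF AEle])
  finally have "(ennreal (cmod (\<kappa> z * s z (f z)) powr (p / 2)) * emeasure lborel T)\<^sup>2
      \<le> (\<integral>\<^sup>+y. A y * B y \<partial>lborel)\<^sup>2"
    by (intro power_mono) auto
  also have "\<dots> \<le> (\<integral>\<^sup>+y. (A y)\<^sup>2 \<partial>lborel) * (\<integral>\<^sup>+y. (B y)\<^sup>2 \<partial>lborel)"
    by (rule Cauchy_Schwarz_nn_integral) measurable
  also have "\<dots> \<le> (\<integral>\<^sup>+y. (A y)\<^sup>2 \<partial>lborel) * emeasure lborel T"
    by (intro mult_left_mono B2) auto
  \<comment> \<open>Squaring produced the volume twice on the left, and Cauchy-Schwarz once on the
    right; one factor, positive and finite, is cancelled.\<close>
  finally have "emeasure lborel T * (ennreal (cmod (\<kappa> z * s z (f z)) powr p) * emeasure lborel T)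
      \<le> emeasure lborel T * (\<integral>\<^sup>+y. (A y)\<^sup>2 \<partial>lborel)"
    by (simp add: power_mult_distrib sq power2_eq_square[of "emeasure lborel T"] mult_ac)
  then have "ennreal (cmod (\<kappa> z * s z (f z)) powr p) * emeasure lborel T \<le> (\<integral>\<^sup>+y. (A y)\<^sup>2 \<partial>lborel)"
    using Tpos T(4) by (subst (asm) ennreal_mult_le_mult_iff) auto
  moreover have "(\<integral>\<^sup>+y. (A y)\<^sup>2 \<partial>lborel) =
      (\<integral>\<^sup>+y\<in>Q. ennreal ((cmod (\<kappa> y) * enn2real (dual_norm E h y (s y))) powr p) \<partial>lborel)"
    unfolding A_def sq by (intro nn_integral_cong) (auto simp: k_def N_def indicator_def)
  moreover have "(cmod (\<kappa> z) * t) powr p \<le> cmod (\<kappa> z * s z (f z)) powr p"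
    using a f(2) t p by (intro powr_mono2) (auto simp: norm_mult mult_left_mono)
  then have "ennreal ((cmod (\<kappa> z) * t) powr p) * emeasure lborel T
      \<le> ennreal (cmod (\<kappa> z * s z (f z)) powr p) * emeasure lborel T"
    by (intro mult_right_mono ennreal_leI) auto
  ultimately show ?thesis unfolding Q_def by (simp only:)
qed

text \<open>The weak form is continuous in \<open>t\<close>, so \<open>t\<close> may tend from below
  to the dual norm at the centre, which is finite by upper semicontinuity in the sense of
  \<open>usc_on\<close>.\<close>

lemma dual_norm_submean:
  fixes E :: "('e, 'n::finite, 'f::complex_hilbert) vbundle"
  assumes E: "holomorphic_vector_bundle D E" and h: "singular_finsler_metric E h"
    and p: "0 < p" and ext: "optimal_Lp_extension D E h p"
    and UD: "U \<subseteq> D" and s: "holomorphic_dual_section E U s"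
    and usc: "usc_on U (\<lambda>x. dual_norm E h x (s x))"
    and T: "holomorphic_cylinder T" "open T" "0 \<in> T" "emeasure lborel T < \<infinity>"
      "\<And>c x. x \<in> T \<Longrightarrow> cmod c \<le> 1 \<Longrightarrow> c *\<^sub>C x \<in> T"
    and Q: "(+) z ` T \<subseteq> U" and \<kappa>: "holomorphic_map_on \<kappa> ((+) z ` T)"
  shows "ennreal ((cmod (\<kappa> z) * enn2real (dual_norm E h z (s z))) powr p) * emeasure lborel T
    \<le> (\<integral>\<^sup>+y\<in>(+) z ` T. ennreal ((cmod (\<kappa> y) * enn2real (dual_norm E h y (s y))) powr p) \<partial>lborel)"
    (is "_ \<le> ?I")
proof -
  have "z \<in> U" using Q T(3) by force
  then have fin: "dual_norm E h z (s z) < \<infinity>" using usc by (simp add: usc_on_def)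
  define n where "n = enn2real (dual_norm E h z (s z))"
  have n: "dual_norm E h z (s z) = ennreal n" "0 \<le> n"
    using fin by (simp_all add: n_def)
  show ?thesis
  proof (cases "n = 0")
    case True
    then show ?thesis by (simp add: n_def)
  next
    case False
    have "((\<lambda>t. ennreal ((cmod (\<kappa> z) * t) powr p) * emeasure lborel T) \<longlongrightarrow>
        ennreal ((cmod (\<kappa> z) * n) powr p) * emeasure lborel T) (at_left n)"
      using p T(4) n False
      by (intro tendsto_mult_ennreal tendsto_ennrealI tendsto_powr' tendsto_intros) auto
    moreover have "eventually (\<lambda>t. ennreal ((cmod (\<kappa> z) * t) powr p) * emeasure lborel T \<le> ?I) (at_left n)"
    proof -
      have "eventually (\<lambda>t. t \<in> {0<..<n}) (at_left n)"
        using False n by (intro eventually_at_left_real) auto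
      then show ?thesis
      proof eventually_elim
        case (elim t)
        then show ?case
          using n by (intro dual_norm_submean_weak[OF E h p ext UD s usc T Q \<kappa>])
            (auto simp: ennreal_lessI)
      qed
    qed
    ultimately show ?thesis
      unfolding n_def[symmetric] by (rule tendsto_upperbound) simp
  qed
qed

section \<open>The maximum principle on complex lines\<close>

text \<open>If no maximum were attained, the open sets \<open>v t < v t'\<close> with
  \<open>t'\<close> in \<open>S\<close> would cover \<open>S\<close>; a finite subcover misses the
  one of its own points \<open>t'\<close> at which \<open>v\<close> is largest.\<close>

lemma usc_attains_max:
  fixes v :: "'a::topological_space \<Rightarrow> real"
  assumes S: "compact S" "S \<noteq> {}" "S \<subseteq> G" and usc: "\<And>c. open {t \<in> G. v t < c}"
  obtains t where "t \<in> S" "\<And>t'. t' \<in> S \<Longrightarrow> v t' \<le> v t"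
proof (rule ccontr)
  assume neg: "\<not> thesis"
  have cover: "S \<subseteq> (\<Union>t'\<in>S. {t \<in> G. v t < v t'})"
  proof
    fix t assume t: "t \<in> S"
    have "\<exists>t'\<in>S. v t < v t'"
    proof (rule ccontr)
      assume "\<not> (\<exists>t'\<in>S. v t < v t')"
      then have "\<And>t'. t' \<in> S \<Longrightarrow> v t' \<le> v t" by (meson not_less)
      with t that neg show False by blast
    qed
    with t S(3) show "t \<in> (\<Union>t'\<in>S. {t \<in> G. v t < v t'})" by blast
  qed
  obtain C where C: "C \<subseteq> S" "finite C" "S \<subseteq> (\<Union>t'\<in>C. {t \<in> G. v t < v t'})"
    using compactE_image[OF S(1) usc cover] by blast
  have "C \<noteq> {}" using C(3) S(2) by auto
  then have "Max (v ` C) \<in> v ` C" using C(2) by simp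
  then obtain b where b: "b \<in> C" "v b = Max (v ` C)" by auto
  then obtain t' where t': "t' \<in> C" "v b < v t'" using C(1,3) by blast
  then have "v t' \<le> v b" using b C(2) by simp
  with t' show False by simp
qed

lemma open_less_continuous:
  fixes n b :: "'a::topological_space \<Rightarrow> real"
  assumes usc: "\<And>c. open {y \<in> U. n y < c}" and "continuous_on UNIV b"
  shows "open {y \<in> U. n y < b y}"
proof -
  have "{y \<in> U. n y < b y} = (\<Union>c. {y \<in> U. n y < c} \<inter> {y. c < b y})"
    using dense by auto (metis dense)
  moreover have "open {y. c < b y}" for c
    using assms(2) by (intro open_Collect_less continuous_intros)
  ultimately show ?thesis using usc by (simp only:) (intro open_UN ballI open_Int)
qed

text \<open>A deficit on a fixed share of the volume outweighs a small excess on the rest. It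
  matters that \<open>m2\<close> is chosen before the volumes: the tube whose thickness depends on
  \<open>m2\<close> comes afterwards.\<close>

lemma sub_tube_mean_less:
  assumes "0 < p" "0 < m1" "m1 < m" and K: "0 < K"
  obtains m2 :: real where "m < m2"
    "\<And>\<mu> \<mu>1. 0 < \<mu> \<Longrightarrow> \<mu>1 \<le> \<mu> \<Longrightarrow> \<mu> \<le> K * \<mu>1 \<Longrightarrow>
      m2 powr p * (\<mu> - \<mu>1) + m1 powr p * \<mu>1 < m powr p * (\<mu>::real)"
proof -
  \<comment> \<open>With this value the excess \<open>e * \<mu> \<le> e * (K * \<mu>1)\<close> is at
    most half of the deficit \<open>(m powr p - m1 powr p) * \<mu>1\<close>.\<close>
  define e where "e = (m powr p - m1 powr p) / (2 * K)"
  have lt: "m1 powr p < m powr p" using assms by (intro powr_less_mono2) auto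
  then have e: "0 < e" using K by (simp add: e_def)
  define m2 where "m2 = (m powr p + e) powr (1 / p)"
  have m2p: "m2 powr p = m powr p + e"
    using assms(1) e by (simp add: m2_def powr_powr add_nonneg_nonneg)
  show thesis
  proof
    show "m < m2"
    proof (rule ccontr)
      assume "\<not> m < m2"
      then have "m2 powr p \<le> m powr p" using assms(1) by (intro powr_mono2) (auto simp: m2_def)
      with m2p e show False by simp
    qed
    fix \<mu> \<mu>1 :: real assume \<mu>: "0 < \<mu>" "\<mu>1 \<le> \<mu>" "\<mu> \<le> K * \<mu>1"
    then have "0 < \<mu>1" using K by (metis less_le_trans zero_less_mult_pos)
    have "e * \<mu> < (m powr p - m1 powr p) * \<mu>1 + e * \<mu>1"
    proof -
      have "e * \<mu> \<le> e * (K * \<mu>1)" using e \<mu> by (intro mult_left_mono) auto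
      also have "\<dots> = (m powr p - m1 powr p) * \<mu>1 / 2" using K by (simp add: e_def)
      also have "\<dots> < (m powr p - m1 powr p) * \<mu>1" using lt \<open>0 < \<mu>1\<close> by simp
      also have "\<dots> \<le> (m powr p - m1 powr p) * \<mu>1 + e * \<mu>1" using e \<open>0 < \<mu>1\<close> by simp
      finally show ?thesis .
    qed
    then show "m2 powr p * (\<mu> - \<mu>1) + m1 powr p * \<mu>1 < m powr p * \<mu>"
      unfolding m2p by (simp add: algebra_simps)
  qed
qed

text \<open>At a maximum point farthest from the centre, part of every small disc lies
  where the function is strictly smaller, by an amount that survives in a sufficiently thin tube
  around the disc; this contradicts the mean value inequality over that tube.\<close>

lemma slice_maximum_principle:
  fixes n :: "complex ^ 'n \<Rightarrow> real"
  assumes U: "open U" and n0: "\<And>y. y \<in> U \<Longrightarrow> 0 \<le> n y" and usc: "\<And>c. open {y \<in> U. n y < c}"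
    and p: "0 < p"
    and submean: "\<And>z \<rho> \<sigma> \<kappa>. 0 < \<rho> \<Longrightarrow> 0 < \<sigma> \<Longrightarrow> (+) z ` tube w 0 \<rho> \<sigma> \<subseteq> U \<Longrightarrow>
      holomorphic_map_on \<kappa> ((+) z ` tube w 0 \<rho> \<sigma>) \<Longrightarrow>
      ennreal ((cmod (\<kappa> z) * n z) powr p) * emeasure lborel (tube w 0 \<rho> \<sigma>)
        \<le> (\<integral>\<^sup>+y\<in>(+) z ` tube w 0 \<rho> \<sigma>. ennreal ((cmod (\<kappa> y) * n y) powr p) \<partial>lborel)"
    and w: "w \<noteq> 0" and r: "0 < r" and disc: "\<And>t. t \<in> cball t0 r \<Longrightarrow> a + t *\<^sub>C w \<in> U"
    and q: "q holomorphic_on UNIV"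
    and bdry: "\<And>t. t \<in> sphere t0 r \<Longrightarrow> n (a + t *\<^sub>C w) \<le> exp (Re (q t))"
  shows "n (a + t0 *\<^sub>C w) \<le> exp (Re (q t0))"
proof (rule ccontr)
  assume neg: "\<not> n (a + t0 *\<^sub>C w) \<le> exp (Re (q t0))"
  \<comment> \<open>Extending exp(-q) from the line as a function of the line coordinate keeps it
    holomorphic on the whole space. The claim becomes a maximum principle for \<open>M\<close> with
    boundary bound 1.\<close>
  define \<kappa> where "\<kappa> y = exp (- q (lcoord w (y - a)))" for y
  define M where "M y = cmod (\<kappa> y) * n y" for y
  define G where "G = {t. a + t *\<^sub>C w \<in> U}"
  define v where "v t = M (a + t *\<^sub>C w)" for t
  have lc: "lcoord w (t *\<^sub>C w) = t" for t
    using w by (simp add: lcoord_scaleC lcoord_self)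
  have v: "v t = n (a + t *\<^sub>C w) / exp (Re (q t))" for t
    by (simp add: v_def M_def \<kappa>_def lc exp_minus divide_inverse norm_inverse mult.commute)
  have hol\<kappa>: "holomorphic_map_on \<kappa> X" for X
    unfolding holomorphic_map_on_def
  proof
    fix y
    define e where "e t = exp (- q t)" for t
    have "e holomorphic_on UNIV" unfolding e_def by (intro holomorphic_intros q)
    then obtain d where "(e has_field_derivative d) (at (lcoord w (y - a)))"
      by (auto simp: holomorphic_on_def field_differentiable_def)
    moreover have "((\<lambda>y. lcoord w (y - a)) has_derivative lcoord w) (at y)"
    proof -
      have "((\<lambda>y. y - a) has_derivative (\<lambda>h. h)) (at y)"
        by (auto intro!: derivative_eq_intros)
      then show ?thesis
        by (rule bounded_linear.has_derivative[OF bounded_linear_lcoord])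
    qed
    ultimately have "((\<lambda>y. e (lcoord w (y - a))) has_derivative (\<lambda>h. d * lcoord w h)) (at y)"
      unfolding has_field_derivative_def by (rule has_derivative_compose[rotated])
    then show "\<exists>f'. (\<kappa> has_derivative f') (at y) \<and> (\<forall>c v. f' (c *\<^sub>C v) = c *\<^sub>C f' v)"
      unfolding \<kappa>_def[abs_def] e_def
      by (intro exI conjI) (assumption, simp add: lcoord_scaleC scaleC_complex_def mult_ac)
  qed
  have cont\<kappa>: "continuous_on UNIV \<kappa>"
    by (rule continuous_on_holomorphic_map[OF hol\<kappa>])
  have \<kappa>0: "0 < cmod (\<kappa> y)" for y by (simp add: \<kappa>_def)
  have uscM: "open {y \<in> U. M y < c}" for c
  proof -
    have "{y \<in> U. M y < c} = {y \<in> U. n y < c / cmod (\<kappa> y)}"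
      using \<kappa>0 by (simp add: M_def pos_less_divide_eq mult.commute)
    moreover have "open {y \<in> U. n y < c / cmod (\<kappa> y)}"
    proof (rule open_less_continuous[OF usc])
      show "continuous_on UNIV (\<lambda>y. c / cmod (\<kappa> y))"
        by (intro continuous_on_divide continuous_on_const continuous_on_norm cont\<kappa>)
          (simp add: \<kappa>_def)
    qed
    ultimately show ?thesis by simp
  qed
  have M0: "0 \<le> M y" if "y \<in> U" for y using n0[OF that] by (simp add: M_def)
  have cont: "continuous_on X (\<lambda>t. a + t *\<^sub>C w)" for X
    by (intro continuous_intros bounded_bilinear.continuous_on[OF bounded_bilinear_scaleC])
  have uscv: "open {t \<in> G. v t < c}" for c
  proof -
    have "{t \<in> G. v t < c} = (\<lambda>t. a + t *\<^sub>C w) -` {y \<in> U. M y < c}"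
      by (auto simp: G_def v_def)
    then show ?thesis using open_vimage[OF uscM cont] by simp
  qed
  have SG: "cball t0 r \<subseteq> G" using disc by (auto simp: G_def)
  obtain tm where tm: "tm \<in> cball t0 r" "\<And>t. t \<in> cball t0 r \<Longrightarrow> v t \<le> v tm"
    using usc_attains_max[OF compact_cball _ SG uscv] r by auto
  define m where "m = v tm"
  have "1 < v t0" using neg by (simp add: v)
  then have m: "1 < m" using tm(2)[of t0] r by (simp add: m_def)
  \<comment> \<open>The points of the disc where the maximum \<open>m\<close> is attained. Upper
    semicontinuity makes this set compact, so a point farthest from \<open>t0\<close>
    exists.\<close>
  define K where "K = cball t0 r - {t \<in> G. v t < m}"
  have "compact K" unfolding K_def by (rule compact_diff[OF compact_cball uscv])
  moreover have "tm \<in> K" using tm(1) by (simp add: K_def m_def)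
  ultimately have "\<exists>t1\<in>K. \<forall>t\<in>K. dist t0 t \<le> dist t0 t1"
    by (intro continuous_attains_sup continuous_intros) auto
  then obtain t1 where t1: "t1 \<in> K" "\<And>t. t \<in> K \<Longrightarrow> dist t0 t \<le> dist t0 t1"
    by blast
  have t1S: "t1 \<in> cball t0 r" and vt1: "v t1 = m"
    using t1(1) SG tm(2)[of t1] by (auto simp: K_def m_def)
  have "t1 \<notin> sphere t0 r"
  proof
    assume "t1 \<in> sphere t0 r"
    then have "v t1 \<le> 1" using bdry[of t1] by (simp add: v)
    with vt1 m show False by simp
  qed
  then have R: "dist t0 t1 < r" using t1S by simp
  define \<rho> where "\<rho> = (r - dist t0 t1) / 2"
  have \<rho>: "0 < \<rho>" using R by (simp add: \<rho>_def)
  have in_disc: "t1 + \<tau> \<in> cball t0 r" if "cmod \<tau> \<le> \<rho>" for \<tau>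
  proof -
    have "dist t0 (t1 + \<tau>) \<le> dist t0 t1 + cmod \<tau>"
      using dist_triangle[of t0 "t1 + \<tau>" t1] by (simp add: dist_norm)
    then show ?thesis using that \<rho> by (simp add: \<rho>_def)
  qed
  \<comment> \<open>The outward direction at \<open>t1\<close>, arbitrary if \<open>t1\<close> is
    the centre. The disc of radius \<open>\<rho> / 4\<close> about \<open>t1 + c\<close>, shifted
    outward by \<open>\<rho> / 2\<close>, consists of points farther from \<open>t0\<close> than
    \<open>t1\<close>, so it avoids \<open>K\<close>; it also stays within distance \<rho> of
    \<open>t1\<close>.\<close>
  define d where "d = (if t1 = t0 then 1 else sgn (t1 - t0))"
  have d: "cmod d = 1" "t1 - t0 = of_real (dist t0 t1) * d"
    by (simp add: d_def norm_sgn)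
      (simp add: d_def sgn_div_norm scaleR_conv_of_real dist_norm norm_minus_commute)
  define c where "c = of_real (\<rho> / 2) * d"
  have cn: "cmod c = \<rho> / 2" using d \<rho> by (simp add: c_def norm_mult)
  have C: "cmod \<tau> \<le> \<rho>" "v (t1 + \<tau>) < m" if "\<tau> \<in> cball c (\<rho> / 4)" for \<tau>
  proof -
    have e: "cmod (\<tau> - c) \<le> \<rho> / 4" using that by (simp add: dist_norm norm_minus_commute)
    have "cmod \<tau> \<le> cmod c + cmod (\<tau> - c)" using norm_triangle_ineq[of c "\<tau> - c"] by simp
    then show le: "cmod \<tau> \<le> \<rho>" using e cn \<rho> by simp
    define b where "b = of_real (dist t0 t1 + \<rho> / 2) * d"
    have "cmod b = dist t0 t1 + \<rho> / 2"
      unfolding b_def norm_mult d(1) norm_of_real using \<rho> by simp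
    moreover have "t1 + \<tau> - t0 = b + (\<tau> - c)"
      using d(2) by (simp add: b_def c_def algebra_simps)
    then have "cmod b - cmod (\<tau> - c) \<le> cmod (t1 + \<tau> - t0)"
      by (simp only: norm_diff_ineq)
    ultimately have "dist t0 t1 + \<rho> / 2 - \<rho> / 4 \<le> cmod (t1 + \<tau> - t0)"
      using e by linarith
    then have "dist t0 t1 < dist t0 (t1 + \<tau>)"
      using \<rho> by (simp add: dist_norm norm_minus_commute)
    then have "t1 + \<tau> \<notin> K" using t1(2)[of "t1 + \<tau>"] by linarith
    then show "v (t1 + \<tau>) < m" using in_disc[OF le] by (auto simp: K_def)
  qed
  have discC: "t1 + \<tau> \<in> G \<and> v (t1 + \<tau>) < m" if "dist c \<tau> \<le> \<rho> / 4" for \<tau>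
    using C[of \<tau>] in_disc[of \<tau>] that SG by auto
  have CG: "cball (t1 + c) (\<rho> / 4) \<subseteq> G" and Cm: "\<And>t. t \<in> cball (t1 + c) (\<rho> / 4) \<Longrightarrow> v t < m"
    using discC[of "t - t1" for t] by (auto simp: dist_norm algebra_simps)
  obtain t2 where t2: "t2 \<in> cball (t1 + c) (\<rho> / 4)" "\<And>t. t \<in> cball (t1 + c) (\<rho> / 4) \<Longrightarrow> v t \<le> v t2"
    using usc_attains_max[OF compact_cball _ CG uscv] \<rho> by auto
  \<comment> \<open>Strictly between the maximum over the outer disc and \<open>m\<close>; positive
    because \<open>v\<close> is nonnegative.\<close>
  define m1 where "m1 = (v t2 + m) / 2"
  have "0 \<le> v t2" using t2(1) CG M0 by (auto simp: G_def v_def)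
  then have m1: "0 < m1" "m1 < m" "v t2 < m1" using Cm[OF t2(1)] m by (auto simp: m1_def)
  have "0 < \<rho> / 4" using \<rho> by simp
  then obtain k :: nat where k: "0 < k"
    "\<And>\<sigma>. emeasure lborel (tube w 0 \<rho> \<sigma>) \<le> of_nat k * emeasure lborel (tube w c (\<rho> / 4) \<sigma>)"
    using emeasure_tube_le_sub_tube[OF w, of "\<rho> / 4" \<rho> c] by blast
  obtain m2 where m2: "m < m2"
    "\<And>\<mu> \<mu>1. 0 < \<mu> \<Longrightarrow> \<mu>1 \<le> \<mu> \<Longrightarrow> \<mu> \<le> real k * \<mu>1 \<Longrightarrow>
      m2 powr p * (\<mu> - \<mu>1) + m1 powr p * \<mu>1 < m powr p * (\<mu>::real)"
    using sub_tube_mean_less[OF p m1(1,2), of "real k"] k(1) by auto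
  \<comment> \<open>A strict bound on a closed disc of the line persists on a neighbourhood of
    uniform size, by compactness and openness of the sublevel sets of \<open>M\<close>. It is used
    for \<open>m2\<close> on the full disc and for \<open>m1\<close> on the outer disc, and \<sigma>
    is the smaller of the two sizes.\<close>
  have thicken: "\<exists>e>0. \<forall>t\<in>cball s \<delta>. ball (a + t *\<^sub>C w) e \<subseteq> {y \<in> U. M y < b}"
    if "\<And>t. t \<in> cball s \<delta> \<Longrightarrow> t \<in> G \<and> v t < b" for s \<delta> b
  proof -
    have "(\<lambda>t. a + t *\<^sub>C w) ` cball s \<delta> \<subseteq> {y \<in> U. M y < b}"
      using that by (auto simp: G_def v_def)
    then obtain e where "0 < e" "(\<Union>y\<in>(\<lambda>t. a + t *\<^sub>C w) ` cball s \<delta>. ball y e) \<subseteq> {y \<in> U. M y < b}"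
      by (rule compact_subset_open_imp_ball_epsilon_subset[OF compact_continuous_image[OF cont compact_cball] uscM])
    then show ?thesis by (intro exI[of _ e]) blast
  qed
  have "\<And>t. t \<in> cball t1 \<rho> \<Longrightarrow> t \<in> G \<and> v t < m2"
  proof -
    fix t assume "t \<in> cball t1 \<rho>"
    then have "t \<in> cball t0 r" using in_disc[of "t - t1"] by (simp add: dist_norm norm_minus_commute)
    then show "t \<in> G \<and> v t < m2" using SG tm(2)[of t] m2(1) by (auto simp: m_def)
  qed
  from thicken[OF this] obtain e1 where e1: "0 < e1"
    "\<And>t. t \<in> cball t1 \<rho> \<Longrightarrow> ball (a + t *\<^sub>C w) e1 \<subseteq> {y \<in> U. M y < m2}" by blast
  have "\<And>t. t \<in> cball (t1 + c) (\<rho> / 4) \<Longrightarrow> t \<in> G \<and> v t < m1"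
    using CG t2(2) m1(3) by (meson le_less_trans subsetD)
  from thicken[OF this] obtain e2 where e2: "0 < e2"
    "\<And>t. t \<in> cball (t1 + c) (\<rho> / 4) \<Longrightarrow> ball (a + t *\<^sub>C w) e2 \<subseteq> {y \<in> U. M y < m1}" by blast
  define \<sigma> where "\<sigma> = min e1 e2"
  have \<sigma>: "0 < \<sigma>" using e1 e2 by (simp add: \<sigma>_def)
  define z where "z = a + t1 *\<^sub>C w"
  define T where "T = tube w 0 \<rho> \<sigma>"
  define T1 where "T1 = tube w c (\<rho> / 4) \<sigma>"
  have near: "dist (a + (t1 + lcoord w x) *\<^sub>C w) (z + x) = norm (x - lcoord w x *\<^sub>C w)" for x
    by (simp add: z_def dist_norm scaleC_add_left norm_minus_commute algebra_simps)
  have TM: "z + x \<in> U \<and> M (z + x) < m2" if "x \<in> T" for x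
  proof -
    have "t1 + lcoord w x \<in> cball t1 \<rho>" using that by (simp add: T_def tube_def dist_norm)
    moreover have "z + x \<in> ball (a + (t1 + lcoord w x) *\<^sub>C w) e1"
      using that near[of x] by (simp add: T_def tube_def \<sigma>_def)
    ultimately show ?thesis using e1(2) by blast
  qed
  have T1M: "M (z + x) < m1" if "x \<in> T1" for x
  proof -
    have "t1 + lcoord w x \<in> cball (t1 + c) (\<rho> / 4)"
      using that by (simp add: T1_def tube_def dist_norm norm_minus_commute)
    moreover have "z + x \<in> ball (a + (t1 + lcoord w x) *\<^sub>C w) e2"
      using that near[of x] by (simp add: T1_def tube_def \<sigma>_def)
    ultimately show ?thesis using e2(2) by blast
  qed
  have T1T: "T1 \<subseteq> T"
  proof
    fix x assume x: "x \<in> T1"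
    have "cmod (lcoord w x) \<le> cmod (lcoord w x - c) + cmod c"
      using norm_triangle_ineq[of "lcoord w x - c" c] by simp
    then show "x \<in> T" using x \<rho> cn by (simp add: T_def T1_def tube_def)
  qed
  have [measurable]: "T \<in> sets borel" "T1 \<in> sets borel"
    unfolding T_def T1_def by (rule borel_open[OF open_tube])+
  have meas: "(+) z ` X \<in> sets borel" and tr: "emeasure lborel ((+) z ` X) = emeasure lborel X"
    if "X \<in> sets borel" for X
    using emeasure_lborel_translate[OF that] by auto
  have Tfin: "emeasure lborel T < \<infinity>" unfolding T_def by (rule emeasure_tube_finite)
  have T1fin: "emeasure lborel T1 < \<infinity>"
    using emeasure_mono[OF T1T, of lborel] Tfin by (simp add: le_less_trans)
  define \<mu> where "\<mu> = measure lborel T"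
  define \<mu>1 where "\<mu>1 = measure lborel T1"
  have \<mu>: "emeasure lborel T = ennreal \<mu>" and \<mu>1: "emeasure lborel T1 = ennreal \<mu>1"
    using Tfin T1fin by (simp_all add: \<mu>_def \<mu>1_def emeasure_eq_ennreal_measure)
  have \<mu>pos: "0 < \<mu>"
    using emeasure_tube_pos[OF \<rho> \<sigma>, of w] \<mu> unfolding T_def[symmetric]
    by (metis ennreal_neg linorder_not_less)
  have \<mu>1nn: "0 \<le> \<mu>1" by (simp add: \<mu>1_def)
  have \<mu>1le: "\<mu>1 \<le> \<mu>"
    using emeasure_mono[OF T1T, of lborel] \<mu> \<mu>1 \<mu>pos by simp
  have \<mu>K: "\<mu> \<le> real k * \<mu>1"
    using k(2)[of \<sigma>] \<mu> \<mu>1 \<mu>1nn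
    by (simp add: T_def[symmetric] T1_def[symmetric] ennreal_of_nat_eq_real_of_nat flip: ennreal_mult)
  have D: "emeasure lborel (T - T1) = ennreal (\<mu> - \<mu>1)"
    using T1fin T1T \<mu>1nn by (subst emeasure_Diff) (auto simp: \<mu> \<mu>1 ennreal_minus)
  have sub: "(+) z ` T \<subseteq> U" using TM by auto
  have "M z = m" using vt1 by (simp add: v_def z_def)
  then have "ennreal (m powr p * \<mu>) = ennreal ((cmod (\<kappa> z) * n z) powr p) * emeasure lborel T"
    using \<mu>pos by (simp add: M_def \<mu> ennreal_mult)
  also have "\<dots> \<le> (\<integral>\<^sup>+y\<in>(+) z ` T. ennreal ((cmod (\<kappa> y) * n y) powr p) \<partial>lborel)"
    unfolding T_def by (rule submean[OF \<rho> \<sigma> sub[unfolded T_def] hol\<kappa>])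
  also have "\<dots> \<le> (\<integral>\<^sup>+y. ennreal (m2 powr p) * indicator ((+) z ` (T - T1)) y
      + ennreal (m1 powr p) * indicator ((+) z ` T1) y \<partial>lborel)"
  proof (rule nn_integral_mono)
    fix y
    show "ennreal ((cmod (\<kappa> y) * n y) powr p) * indicator ((+) z ` T) y \<le>
      ennreal (m2 powr p) * indicator ((+) z ` (T - T1)) y + ennreal (m1 powr p) * indicator ((+) z ` T1) y"
    proof (cases "y \<in> (+) z ` T")
      case True
      then obtain x where x: "x \<in> T" "y = z + x" by blast
      have M: "cmod (\<kappa> y) * n y = M (z + x)" by (simp add: M_def x)
      have i: "indicator ((+) z ` X) y = (indicator X x :: ennreal)" for X
        using x by (auto simp: indicator_def)
      have "0 \<le> M (z + x)" using TM[OF x(1)] M0 by blast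
      then show ?thesis
        unfolding i M using x(1) TM[OF x(1)] T1M[of x] p
        by (cases "x \<in> T1") (auto intro!: ennreal_leI powr_mono2)
    qed simp
  qed
  also have "\<dots> = ennreal (m2 powr p) * emeasure lborel ((+) z ` (T - T1))
      + ennreal (m1 powr p) * emeasure lborel ((+) z ` T1)"
    using meas[of "T - T1"] meas[of T1] by (subst nn_integral_add) (simp_all add: nn_integral_cmult_indicator)
  also have "\<dots> = ennreal (m2 powr p * (\<mu> - \<mu>1) + m1 powr p * \<mu>1)"
    using \<mu>1le \<mu>1nn by (simp add: tr D \<mu>1 flip: ennreal_mult ennreal_plus)
  finally have "m powr p * \<mu> \<le> m2 powr p * (\<mu> - \<mu>1) + m1 powr p * \<mu>1"
    using \<mu>1le \<mu>1nn by (subst (asm) ennreal_le_iff) auto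
  with m2(2)[OF \<mu>pos \<mu>1le \<mu>K] show False by simp
qed

text \<open>Serves the degenerate direction \<open>w = 0\<close>, over which
  \<open>plurisubharmonic_on\<close> also quantifies. The function is then constant along the slice,
  no tube is available, and the maximum modulus principle for \<open>of_real c * exp (- q t)\<close>
  suffices.\<close>

lemma slice_maximum_principle_const:
  assumes q: "q holomorphic_on UNIV" and r: "0 < r" and c: "0 \<le> c"
    and bdry: "\<And>t. t \<in> sphere t0 r \<Longrightarrow> c \<le> exp (Re (q t))"
  shows "c \<le> exp (Re (q t0))"
proof -
  have "cmod (of_real c * exp (- q t0)) \<le> 1"
  proof (rule maximum_modulus_frontier[of "\<lambda>t. of_real c * exp (- q t)" "cball t0 r" 1 t0])
    show "(\<lambda>t. of_real c * exp (- q t)) holomorphic_on interior (cball t0 r)"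
      by (intro holomorphic_intros holomorphic_on_subset[OF q]) auto
    show "continuous_on (closure (cball t0 r)) (\<lambda>t. of_real c * exp (- q t))"
      by (intro holomorphic_on_imp_continuous_on holomorphic_intros holomorphic_on_subset[OF q]) auto
    show "cmod (of_real c * exp (- q t)) \<le> 1" if "t \<in> frontier (cball t0 r)" for t
      using bdry[of t] that r c
      by (simp add: norm_mult norm_exp_eq_Re exp_minus[of "Re _"] pos_divide_le_eq flip: divide_inverse)
  qed (use r in auto)
  then show ?thesis
    using c by (simp add: norm_mult norm_exp_eq_Re exp_minus[of "Re _"] pos_divide_le_eq flip: divide_inverse)
qed

section \<open>From the maximum principle to plurisubharmonicity of the logarithm\<close>

lemma ennreal_log_power2:
  assumes "0 \<le> n"
  shows "ennreal_log ((ennreal n)\<^sup>2) = (if n = 0 then - \<infinity> else ereal (2 * ln n))"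
proof -
  have "(ennreal n)\<^sup>2 = ennreal (n\<^sup>2)" using assms by (simp add: ennreal_power)
  then show ?thesis using assms by (auto simp: ennreal_log_def ln_realpow)
qed

lemma ennreal_log_power2_le_iff:
  assumes "0 \<le> n"
  shows "ennreal_log ((ennreal n)\<^sup>2) \<le> ereal y \<longleftrightarrow> n \<le> exp (y / 2)"
proof (cases "n = 0")
  case False
  then have "2 * ln n \<le> y \<longleftrightarrow> n \<le> exp (y / 2)"
    using assms ln_le_cancel_iff[of n "exp (y / 2)"] by auto
  then show ?thesis using False assms by (simp add: ennreal_log_power2)
qed (simp add: ennreal_log_def)

lemma ennreal_log_power2_less_iff:
  assumes "0 \<le> n"
  shows "ennreal_log ((ennreal n)\<^sup>2) < ereal y \<longleftrightarrow> n < exp (y / 2)"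
proof (cases "n = 0")
  case False
  then have "2 * ln n < y \<longleftrightarrow> n < exp (y / 2)"
    using assms ln_less_cancel_iff[of n "exp (y / 2)"] by auto
  then show ?thesis using False assms by (simp add: ennreal_log_power2)
qed (simp add: ennreal_log_def)

theorem theorem1p3:
  fixes D :: "(complex ^ 'n) set"
    and E :: "('e, 'n::finite, 'f::{complex_hilbert, second_countable_topology}) vbundle"
    and h :: "'e \<Rightarrow> ennreal"
    and p :: real
  assumes "open D" and "connected D" and "D \<noteq> {}"
    and "holomorphic_vector_bundle D E"
    and "singular_finsler_metric E h"
    and "\<And>U s. open U \<Longrightarrow> U \<subseteq> D \<Longrightarrow> holomorphic_dual_section E U s \<Longrightarrow>
           usc_on U (\<lambda>x. dual_norm E h x (s x))"
    and "0 < p"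
    and "optimal_Lp_extension D E h p"
  shows "griffiths_semipositive D E h"
  unfolding griffiths_semipositive_def
proof (intro allI impI, elim conjE)
  fix U s assume U: "open U" and UD: "U \<subseteq> D" and s: "holomorphic_dual_section E U s"
  have usc: "usc_on U (\<lambda>x. dual_norm E h x (s x))" by (rule assms(6)[OF U UD s])
  \<comment> \<open>Nothing is lost on \<open>U\<close>, since \<open>usc_on\<close> includes
    finiteness of the dual norm.\<close>
  define n where "n x = enn2real (dual_norm E h x (s x))" for x
  define u where "u x = ennreal_log ((dual_norm E h x (s x))\<^sup>2)" for x
  have n: "dual_norm E h x (s x) = ennreal (n x)" if "x \<in> U" for x
    using usc that by (simp add: n_def usc_on_def)
  have n0: "0 \<le> n x" for x by (simp add: n_def)
  have usc_n: "open {y \<in> U. n y < c}" for c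
  proof -
    have "{y \<in> U. n y < c} = {y \<in> U. dual_norm E h y (s y) < ennreal c}"
      using n n0 by (auto simp: ennreal_less_iff)
    moreover have "openin (top_of_set U) {y \<in> U. dual_norm E h y (s y) < ennreal c}"
      using usc by (simp add: usc_on_def)
    ultimately show ?thesis using U by (simp add: openin_open_eq)
  qed
  have u: "u x = ennreal_log ((ennreal (n x))\<^sup>2)" if "x \<in> U" for x
    using n[OF that] by (simp add: u_def)
  have u_top: "u x < \<infinity>" if "x \<in> U" for x
    using u[OF that] n0[of x] by (simp add: ennreal_log_power2)
  have u_open: "open {x \<in> U. u x < c}" for c
  proof (cases c)
    case (real y)
    have "{x \<in> U. u x < c} = {x \<in> U. n x < exp (y / 2)}"
      using u n0 by (auto simp: real ennreal_log_power2_less_iff)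
    then show ?thesis using usc_n by simp
  next
    case PInf
    then have "{x \<in> U. u x < c} = U" using u_top by auto
    then show ?thesis using U by simp
  qed simp
  have maximum: "n (a + t0 *\<^sub>C w) \<le> exp (Re (q t0))"
    if r: "0 < r" and disc: "\<And>t. t \<in> cball t0 r \<Longrightarrow> a + t *\<^sub>C w \<in> U" and q: "q holomorphic_on UNIV"
      and bdry: "\<And>t. t \<in> sphere t0 r \<Longrightarrow> n (a + t *\<^sub>C w) \<le> exp (Re (q t))" for a w t0 r q
  proof (cases "w = 0")
    case True
    have "t *\<^sub>C w = 0" for t using True by (simp add: scaleC_zero_right)
    with slice_maximum_principle_const[OF q r n0, of t0 a] bdry show ?thesis by simp
  next
    case False
    show ?thesis
    proof (rule slice_maximum_principle[OF U n0 usc_n assms(7) _ False r disc q bdry])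
      fix z :: "complex ^ 'n" and \<rho> \<sigma> :: real and \<kappa> :: "complex ^ 'n \<Rightarrow> complex"
      assume "0 < \<rho>" "0 < \<sigma>" "(+) z ` tube w 0 \<rho> \<sigma> \<subseteq> U" "holomorphic_map_on \<kappa> ((+) z ` tube w 0 \<rho> \<sigma>)"
      then show "ennreal ((cmod (\<kappa> z) * n z) powr p) * emeasure lborel (tube w 0 \<rho> \<sigma>)
        \<le> (\<integral>\<^sup>+y\<in>(+) z ` tube w 0 \<rho> \<sigma>. ennreal ((cmod (\<kappa> y) * n y) powr p) \<partial>lborel)"
        unfolding n_def
        by (intro dual_norm_submean[OF assms(4,5,7,8) UD s usc] holomorphic_cylinder_tube False
            open_tube zero_mem_tube emeasure_tube_finite tube_scaleC)
    qed
  qed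
  have "subharmonic_on {t. a + t *\<^sub>C w \<in> U} (\<lambda>t. u (a + t *\<^sub>C w))" for a w
    unfolding subharmonic_on_def
  proof (intro conjI allI impI)
    define G where "G = {t. a + t *\<^sub>C w \<in> U}"
    have cont: "continuous_on UNIV (\<lambda>t. a + t *\<^sub>C w)"
      by (intro continuous_intros bounded_bilinear.continuous_on[OF bounded_bilinear_scaleC])
    have openG: "open G"
      using open_vimage[OF U cont] by (simp add: G_def vimage_def)
    then show "open {t. a + t *\<^sub>C w \<in> U}" by (simp add: G_def)
    have usc_on_subset: "usc_on X (\<lambda>t. u (a + t *\<^sub>C w))" if "X \<subseteq> G" for X
      unfolding usc_on_def
    proof (intro conjI ballI allI)
      show "u (a + t *\<^sub>C w) < top" if "t \<in> X" for t
        using u_top[of "a + t *\<^sub>C w"] that \<open>X \<subseteq> G\<close> by (auto simp: G_def top_ereal_def)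
      fix c
      have "{t \<in> X. u (a + t *\<^sub>C w) < c} = X \<inter> ((\<lambda>t. a + t *\<^sub>C w) -` {x \<in> U. u x < c})"
        using that by (auto simp: G_def)
      then show "openin (top_of_set X) {t \<in> X. u (a + t *\<^sub>C w) < c}"
        using open_vimage[OF u_open cont] by (auto simp: openin_open)
    qed
    then show "usc_on {t. a + t *\<^sub>C w \<in> U} (\<lambda>t. u (a + t *\<^sub>C w))"
      by (simp add: G_def)
    fix t0 r assume "0 < r \<and> cball t0 r \<subseteq> {t. a + t *\<^sub>C w \<in> U}"
    then have r: "0 < r" and disc: "cball t0 r \<subseteq> G" by (auto simp: G_def)
    have inU: "a + t *\<^sub>C w \<in> U" if "t \<in> cball t0 r" for t
      using disc that by (auto simp: G_def)
    show "u (a + t0 *\<^sub>C w) \<le> circle_mean (\<lambda>t. u (a + t *\<^sub>C w)) t0 r"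
    proof (rule le_circle_mean_usc[OF usc_on_subset r])
      show "sphere t0 r \<subseteq> G" using disc by auto
      fix q assume q: "q holomorphic_on UNIV"
        and le: "\<And>t. t \<in> sphere t0 r \<Longrightarrow> u (a + t *\<^sub>C w) \<le> ereal (Re (q t))"
      \<comment> \<open>The function \<open>u\<close> is the logarithm of the squared dual norm, so
        a majorant \<open>q\<close> of \<open>u\<close> corresponds to the majorant
        \<open>q / 2\<close> of the logarithm of \<open>n\<close>.\<close>
      have "n (a + t0 *\<^sub>C w) \<le> exp (Re (q t0 / 2))"
      proof (rule maximum[OF r inU])
        show "(\<lambda>t. q t / 2) holomorphic_on UNIV" by (intro holomorphic_intros q) auto
        show "n (a + t *\<^sub>C w) \<le> exp (Re (q t / 2))" if "t \<in> sphere t0 r" for t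
          using le[OF that] u[OF inU, of t] that n0 by (simp add: ennreal_log_power2_le_iff)
      qed
      then show "u (a + t0 *\<^sub>C w) \<le> ereal (Re (q t0))"
        using u[OF inU, of t0] r n0 by (simp add: ennreal_log_power2_le_iff)
    qed
  qed
  moreover have "usc_on U u"
    using u_top u_open by (auto simp: usc_on_def top_ereal_def openin_open_eq[OF U])
  ultimately show "plurisubharmonic_on U (\<lambda>x. ennreal_log ((dual_norm E h x (s x))\<^sup>2))"
    using U by (simp add: plurisubharmonic_on_def u_def[symmetric] flip: u_def[abs_def])
qed

end
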